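(* Let $n\ge 6$ and let $C_n$ be a cyclic group of order $n$. Suppose that one of the following two conditions, which are equivalent to each other, holds: (a) $\Delta_{\rho}^*(C_n)\setminus\{1,n-2\}\ne\emptyset$; (b) there is an integer $a\in[2,\lfloor n/2\rfloor]$ with $\gcd(n,a)=1$ such that $\gcd(a_0-1,a_1,\ldots,a_{m-1},a_m-1)>1$, where $[a_0,a_1,\ldots,a_m]$ is the regular continued fraction expansion of $n/a$ (i.e. the one with $a_m>1$). Then $\mathcal L(C_n)\not\subset\mathcal L(C_2^{n-1})$.
   Context: $C_2^{n-1}$ is the direct sum of $n-1$ copies of the group of order $2$. $\mathbb N$ denotes the positive integers, $\mathbb N_0=\mathbb N\cup\{0\}$. For a finite additive abelian group $G$, $\mathcal F(G)$ is the free abelian monoid with basis $G$ (written multiplicatively), and $\mathcal B(G)=\{g_1\cdots g_\ell\in\mathcal F(G)\mid g_1+\ldots+g_\ell=0\}$ is the monoid of zero-sum sequences over $G$. An atom of $\mathcal B(G)$ is a non-identity element that is not a product of two non-identity elements of $\mathcal B(G)$. For $A\in\mathcal B(G)$, $A\ne 1$, $\mathsf L(A)$ is the set of all $k\in\mathbb N$ such that $A$ is a product of $k$ atoms; $\mathsf L(1)=\{0\}$. $\mathcal L(G)=\{\mathsf L(A)\mid A\in\mathcal B(G)\}$. For nonempty finite $L\subset\mathbb N$, $\rho(L)=\max L/\min L$, and $\rho(\{0\})=1$; $\rho(G)=\sup\{\rho(L)\mid L\in\mathcal L(G)\}$. For a finite set $L=\{m_1<\ldots<m_k\}\subset\mathbb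 Z$, $\Delta(L)=\{m_i-m_{i-1}\mid 2\le i\le k\}$. For $A\in\mathcal B(G)$ let $\Delta([A])=\bigcup_{k\in\mathbb N_0}\Delta(\mathsf L(A^k))$. Then $\Delta_\rho^*(G)=\{\min\Delta([A])\mid A\in\mathcal B(G),\ \rho(\mathsf L(A))=\rho(G)\}$. The regular continued fraction expansion $n/a=[a_0,\ldots,a_m]=a_0+\cfrac{1}{a_1+\cfrac{1}{\ddots+\cfrac1{a_m}}}$ has positive integers $a_0,\ldots,a_m$ and $a_m>1$. *)

theory Defs
  imports
    "HOL-Algebra.FiniteProduct"
    "HOL-Algebra.Product_Groups"
    "HOL-Algebra.Elementary_Groups"
    "HOL-Library.Multiset"
    "HOL-Library.Extended_Real"
begin

section \<open>Zero-sum sequences\<close>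

text \<open>
  HOL-Algebra writes groups multiplicatively, so the additive group \<open>G\<close> of the mathematical text
  has operation \<open>\<otimes>\<^bsub>G\<^esub>\<close> and zero \<open>\<one>\<^bsub>G\<^esub>\<close>. The free abelian
  monoid over \<open>G\<close> consists of the finite multisets over \<open>carrier G\<close>: its product is
  multiset sum \<open>+\<close>, its identity is \<open>{#}\<close>, and the power \<open>A\<^sup>k\<close> is
  \<open>repeat_mset k A\<close>.
\<close>

text \<open>
  The sum of a sequence, with equal terms collected. (A fold of the group operation over the
  multiset would need commutativity outside the carrier.)
\<close>
definition seq_sum :: "('a, 'b) monoid_scheme \<Rightarrow> 'a multiset \<Rightarrow> 'a" where
  "seq_sum G S = (\<Otimes>\<^bsub>G\<^esub>g\<in>set_mset S. g [^]\<^bsub>G\<^esub> count S g)"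

definition zero_sum_seqs :: "('a, 'b) monoid_scheme \<Rightarrow> 'a multiset set" where
  "zero_sum_seqs G = {S. set_mset S \<subseteq> carrier G \<and> seq_sum G S = \<one>\<^bsub>G\<^esub>}"

definition zs_atoms :: "('a, 'b) monoid_scheme \<Rightarrow> 'a multiset set" where
  "zs_atoms G = {U \<in> zero_sum_seqs G. U \<noteq> {#} \<and>
     \<not> (\<exists>B\<in>zero_sum_seqs G. \<exists>C\<in>zero_sum_seqs G. B \<noteq> {#} \<and> C \<noteq> {#} \<and> U = B + C)}"


section \<open>Sets of lengths\<close>

definition length_set :: "('a, 'b) monoid_scheme \<Rightarrow> 'a multiset \<Rightarrow> nat set" where
  "length_set G A =
     (if A = {#} then {0}
      else {k. 0 < k \<and> (\<exists>Z. set_mset Z \<subseteq> zs_atoms G \<and> size Z = k \<and> \<Sum>\<^sub># Z = A)})"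

definition length_sets :: "('a, 'b) monoid_scheme \<Rightarrow> nat set set" where
  "length_sets G = length_set G ` zero_sum_seqs G"

definition elasticity :: "nat set \<Rightarrow> real" where
  "elasticity L = (if L = {0} then 1 else real (Max L) / real (Min L))"

text \<open>The supremum is taken in the extended reals, so that it exists unconditionally.\<close>
definition group_elasticity :: "('a, 'b) monoid_scheme \<Rightarrow> ereal" where
  "group_elasticity G = (SUP L\<in>length_sets G. ereal (elasticity L))"

text \<open>Differences of consecutive elements; as \<open>x < y\<close>, the subtraction does not truncate.\<close>
definition distances :: "nat set \<Rightarrow> nat set" where
  "distances L = {y - x | x y. x \<in> L \<and> y \<in> L \<and> x < y \<and> \<not> (\<exists>z\<in>L. x < z \<and> z < y)}"

definition power_distances :: "('a, 'b) monoid_scheme \<Rightarrow> 'a multiset \<Rightarrow> nat set" where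
  "power_distances G A = (\<Union>k. distances (length_set G (repeat_mset k A)))"

text \<open>
  \<open>Inf\<close> on \<open>nat\<close> is the minimum of a nonempty set, with \<open>Inf {} = 0\<close>. The empty
  case does not occur once the group elasticity exceeds \<open>1\<close> (finite groups of order at least
  \<open>3\<close>): then a set of lengths of maximal elasticity has two elements.
\<close>
definition Delta_rho_star :: "('a, 'b) monoid_scheme \<Rightarrow> nat set" where
  "Delta_rho_star G =
     {Inf (power_distances G A) | A.
        A \<in> zero_sum_seqs G \<and> ereal (elasticity (length_set G A)) = group_elasticity G}"


section \<open>Regular continued fractions\<close>

text \<open>The value of a finite continued fraction; the empty list is a junk case.\<close>
fun cfrac_value :: "nat list \<Rightarrow> rat" where
  "cfrac_value [] = 0"
| "cfrac_value [a] = of_nat a"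
| "cfrac_value (a # b # as) = of_nat a + 1 / cfrac_value (b # as)"

definition is_regular_cfrac :: "nat list \<Rightarrow> rat \<Rightarrow> bool" where
  "is_regular_cfrac as q \<longleftrightarrow>
     as \<noteq> [] \<and> (\<forall>a\<in>set as. 0 < a) \<and> last as > 1 \<and> cfrac_value as = q"

text \<open>
  \<open>gcd(a\<^sub>0 - 1, a\<^sub>1, \<dots>, a\<^sub>m\<^sub>-\<^sub>1, a\<^sub>m - 1)\<close> for
  \<open>as = [a\<^sub>0, \<dots>, a\<^sub>m]\<close> with \<open>m \<ge> 1\<close> and positive entries.
\<close>
definition cfrac_gcd :: "nat list \<Rightarrow> nat" where
  "cfrac_gcd as =
     Gcd ({as ! 0 - 1, last as - 1} \<union> {as ! i | i. 0 < i \<and> i < length as - 1})"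

definition cfrac_condition :: "nat \<Rightarrow> bool" where
  "cfrac_condition n \<longleftrightarrow>
     (\<exists>a\<in>{2..n div 2}. gcd n a = 1 \<and>
        (\<exists>as. is_regular_cfrac as (of_nat n / of_nat a) \<and> cfrac_gcd as > 1))"


section \<open>Elementary 2-groups\<close>

definition elementary_2_group :: "nat \<Rightarrow> (nat \<Rightarrow> int) monoid" where
  "elementary_2_group r = sum_group {..<r} (\<lambda>_. integer_mod_group 2)"

end

theory Submission
  imports Defs "HOL-Algebra.Multiplicative_Group" "HOL-Number_Theory.Cong"
begin

text \<open>
  The group operation is spoken of additively in the comments, as in the theory of zero-sum
  sequences; in the formulas it is \<open>\<otimes>\<close>, the negative of \<open>g\<close> is \<open>inv g\<close>, and the sum of two
  multisets is the product of sequences.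

  Let \<open>G\<close> be cyclic of order \<open>n\<close>. Atoms have length at most
  \<open>n\<close>, and length at least 2 except for the one-term atom \<open>0\<close>. Hence \<open>\<rho>(G) = n / 2\<close>, and a
  sequence \<open>A\<close> attains it only if it is both a product of atoms of length \<open>n\<close> and a product of
  atoms of length 2 (\<open>Max_Min_length_set\<close>). Atoms of length \<open>n\<close> are powers \<open>g\<^sup>n\<close> of generators, and
  atoms of length 2 are pairs \<open>g (-g)\<close>; so the support of \<open>A\<close> is a set of generators closed
  under negation (\<open>extremal_support\<close>).

  The number \<open>d = min \<Delta>([A])\<close> is the largest \<open>d\<close> such that any two
  factorization lengths of a sequence over the support of \<open>A\<close> are congruent modulo \<open>d\<close>
  (\<open>length_modulus_min_power_distance\<close>, \<open>length_modulus_dvd_power_distance\<close>). For the support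
  \<open>{g, -g}\<close> this is \<open>n - 2\<close>. Any other support contains a set \<open>{g, -g, ag, -ag}\<close> with \<open>a\<close> coprime
  to \<open>n\<close> and \<open>2 \<le> a < n / 2\<close>, and on such a set the congruence holds if and only if an explicit additive
  function, the height, is congruent to 1 at every atom.

  The atoms over \<open>{g, -g, ag, -ag}\<close> are, apart from a few
  obvious ones, the minimal solutions of \<open>x + ay = nk\<close> and of \<open>x + nk = ay\<close>. A step
  \<open>q = cp + r\<close> of the Euclidean algorithm maps the minimal solutions belonging to \<open>(p, q)\<close>
  to those belonging to \<open>(p, r)\<close>, up to finitely many that can be written down, and it
  preserves the congruences exactly when \<open>d\<close> divides the partial quotient \<open>c\<close> (\<open>uniform_step\<close>).
  Running the algorithm on \<open>(a, n - a)\<close>, whose continued fraction is \<open>[a\<^sub>0 - 1, a\<^sub>1, \<dots>, a\<^sub>m]\<close>,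
  gives the condition that \<open>d\<close> divides \<open>gcd(a\<^sub>0 - 1, a\<^sub>1, \<dots>, a\<^sub>m\<^sub>-\<^sub>1, a\<^sub>m - 1)\<close>
  (\<open>dvd_cfrac_gcd_iff\<close>). As this gcd is at most \<open>a\<^sub>0 - 1 < n - 2\<close>, the two conditions of the
  theorem are equivalent.

  For the second part, let \<open>d\<close> be neither 1 nor \<open>n - 2\<close>; as \<open>d\<close> divides \<open>n - 2\<close>, this means
  \<open>1 < d < n - 2\<close>. Suppose that \<open>L(A\<^sup>k) = L(B)\<close>, where
  \<open>k\<close> is such that \<open>d\<close> is a distance of \<open>L(A\<^sup>k)\<close> and \<open>B\<close> is a sequence over \<open>C\<^sub>2\<^sup>n\<^sup>-\<^sup>1\<close>. Then
  \<open>B\<close> is a product of atoms of length \<open>n\<close>, and also a product of squares. If the atoms of length \<open>n\<close> are all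
  equal, then the elements of \<open>L(B)\<close> are congruent modulo \<open>n - 2\<close>, contrary to the distance \<open>d\<close>.
  If two of them, \<open>E\<close> and \<open>F\<close>, differ, then each term of \<open>F\<close> outside \<open>E\<close> is the sum of the two halves of
  a bipartition of \<open>E\<close>; two of these bipartitions cross (\<open>ex_crossing\<close>), and for the corresponding terms \<open>f\<close>
  and \<open>f'\<close> the sequence \<open>f\<^sup>2 f'\<^sup>2 E\<close> is a product of three atoms and also of two. It divides \<open>B\<close>, so
  \<open>L(B)\<close> contains two consecutive integers, contrary to all differences in \<open>L(A\<^sup>k)\<close> being
  multiples of \<open>d\<close>.
\<close>

section \<open>Zero-sum sequences over an abelian group\<close>

text \<open>
  For a sequence \<open>A\<close> of maximal elasticity, \<open>min \<Delta>([A])\<close> is the largest such \<open>d\<close> for the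
  support of \<open>A\<close>. This form mentions neither powers nor consecutive lengths, and it passes to subsets.
\<close>
definition length_modulus :: "('a, 'b) monoid_scheme \<Rightarrow> 'a set \<Rightarrow> nat \<Rightarrow> bool" where
  "length_modulus G X d \<longleftrightarrow>
     (\<forall>B\<in>zero_sum_seqs G. set_mset B \<subseteq> X \<longrightarrow>
        (\<forall>k\<in>length_set G B. \<forall>l\<in>length_set G B. [k = l] (mod d)))"

lemma length_modulusD:
  assumes "length_modulus G X d" "B \<in> zero_sum_seqs G" "set_mset B \<subseteq> X"
    "k \<in> length_set G B" "l \<in> length_set G B"
  shows "[k = l] (mod d)"
  using assms unfolding length_modulus_def by blast

lemma length_modulus_subset:
  assumes "length_modulus G X d" "X' \<subseteq> X"
  shows "length_modulus G X' d"
  using assms unfolding length_modulus_def by blast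

context comm_group
begin

lemma seq_sum_superset:
  assumes "finite X" "set_mset S \<subseteq> X" "X \<subseteq> carrier G"
  shows "seq_sum G S = (\<Otimes>g\<in>X. g [^] count S g)"
  unfolding seq_sum_def
proof (rule finprod_mono_neutral_cong_left)
  show "i [^] count S i = \<one>" if "i \<in> X - set_mset S" for i
    using that by (auto simp: not_in_iff)
  show "(\<lambda>g. g [^] count S g) \<in> X \<rightarrow> carrier G"
    using assms by auto
qed (use assms in auto)

lemma seq_sum_closed [simp]: "set_mset S \<subseteq> carrier G \<Longrightarrow> seq_sum G S \<in> carrier G"
  unfolding seq_sum_def by (rule finprod_closed) auto

lemma seq_sum_union:
  assumes "set_mset S \<subseteq> carrier G" "set_mset T \<subseteq> carrier G"
  shows "seq_sum G (S + T) = seq_sum G S \<otimes> seq_sum G T"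
proof -
  let ?X = "set_mset S \<union> set_mset T"
  have "seq_sum G (S + T) = (\<Otimes>g\<in>?X. g [^] count (S + T) g)"
    by (rule seq_sum_superset) (use assms in auto)
  also have "\<dots> = (\<Otimes>g\<in>?X. g [^] count S g \<otimes> g [^] count T g)"
    by (rule finprod_cong') (use assms in \<open>auto simp: nat_pow_mult\<close>)
  also have "\<dots> = (\<Otimes>g\<in>?X. g [^] count S g) \<otimes> (\<Otimes>g\<in>?X. g [^] count T g)"
    by (rule finprod_multf) (use assms in auto)
  also have "\<dots> = seq_sum G S \<otimes> seq_sum G T"
    using assms seq_sum_superset[of ?X S] seq_sum_superset[of ?X T] by simp
  finally show ?thesis .
qed

lemma seq_sum_empty [simp]: "seq_sum G {#} = \<one>"
  by (simp add: seq_sum_def)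

lemma seq_sum_replicate: "x \<in> carrier G \<Longrightarrow> seq_sum G (replicate_mset k x) = x [^] k"
  using seq_sum_superset[of "{x}" "replicate_mset k x"] by simp

lemma seq_sum_add_mset:
  assumes "x \<in> carrier G" "set_mset S \<subseteq> carrier G"
  shows "seq_sum G (add_mset x S) = x \<otimes> seq_sum G S"
  using seq_sum_union[of "{#x#}" S] seq_sum_replicate[of x 1] assms by simp

lemma zero_sum_empty [simp]: "{#} \<in> zero_sum_seqs G"
  by (simp add: zero_sum_seqs_def)

lemma zero_sum_add:
  "A \<in> zero_sum_seqs G \<Longrightarrow> B \<in> zero_sum_seqs G \<Longrightarrow> A + B \<in> zero_sum_seqs G"
  by (auto simp: zero_sum_seqs_def seq_sum_union)

lemma zero_sum_cancel:
  assumes "A + B \<in> zero_sum_seqs G" "A \<in> zero_sum_seqs G"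
  shows "B \<in> zero_sum_seqs G"
  using assms by (auto simp: zero_sum_seqs_def seq_sum_union)

lemma zero_sum_diff:
  assumes "A \<in> zero_sum_seqs G" "B \<in> zero_sum_seqs G" "A \<subseteq># B"
  shows "B - A \<in> zero_sum_seqs G"
  using assms by (auto intro: zero_sum_cancel[of A])

lemma zero_sum_repeat: "A \<in> zero_sum_seqs G \<Longrightarrow> repeat_mset k A \<in> zero_sum_seqs G"
  by (induction k) (auto simp: zero_sum_add)

lemma zero_sum_sum_mset:
  "set_mset Y \<subseteq> zero_sum_seqs G \<Longrightarrow> \<Sum>\<^sub># Y \<in> zero_sum_seqs G"
  by (induction Y) (auto simp: zero_sum_add)

lemma zs_atoms_iff:
  "U \<in> zs_atoms G \<longleftrightarrow> U \<in> zero_sum_seqs G \<and> U \<noteq> {#} \<and>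
     (\<forall>V\<in>zero_sum_seqs G. V \<subseteq># U \<longrightarrow> V = {#} \<or> V = U)"
  (is "?l \<longleftrightarrow> ?r")
proof
  assume l: ?l
  show ?r
  proof (intro conjI ballI impI)
    fix V assume V: "V \<in> zero_sum_seqs G" "V \<subseteq># U"
    have UV: "U - V \<in> zero_sum_seqs G" "U = V + (U - V)"
      using l V zero_sum_diff by (auto simp: zs_atoms_def)
    show "V = {#} \<or> V = U"
    proof (rule ccontr)
      assume "\<not> (V = {#} \<or> V = U)"
      then have "V \<noteq> {#}" "U - V \<noteq> {#}" using UV(2) by auto
      with UV V(1) show False using l unfolding zs_atoms_def by blast
    qed
  qed (use l in \<open>auto simp: zs_atoms_def\<close>)
next
  assume r: ?r
  show ?l
    unfolding zs_atoms_def using r by (auto simp: add_eq_self_zero) 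
qed

lemma zs_atomD:
  assumes "U \<in> zs_atoms G"
  shows "U \<in> zero_sum_seqs G" "U \<noteq> {#}" "set_mset U \<subseteq> carrier G" "0 < size U"
  using assms by (auto simp: zs_atoms_def zero_sum_seqs_def nonempty_has_size)

lemma zero_sum_of_atoms: "set_mset Y \<subseteq> zs_atoms G \<Longrightarrow> \<Sum>\<^sub># Y \<in> zero_sum_seqs G"
  by (rule zero_sum_sum_mset) (auto dest: zs_atomD(1))

lemma zs_atom_minimal:
  "U \<in> zs_atoms G \<Longrightarrow> V \<in> zero_sum_seqs G \<Longrightarrow> V \<subseteq># U \<Longrightarrow> V = {#} \<or> V = U"
  using zs_atoms_iff by blast

lemma ex_factorization:
  assumes "A \<in> zero_sum_seqs G"
  shows "\<exists>Y. set_mset Y \<subseteq> zs_atoms G \<and> \<Sum>\<^sub># Y = A"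
  using assms
proof (induction "size A" arbitrary: A rule: less_induct)
  case less
  consider "A = {#}" | "A \<in> zs_atoms G" | "A \<noteq> {#}" "A \<notin> zs_atoms G" by blast
  then show ?case
  proof cases
    case 1
    then show ?thesis by (intro exI[of _ "{#}"]) auto
  next
    case 2
    then show ?thesis by (intro exI[of _ "{#A#}"]) auto
  next
    case 3
    then obtain B C where BC: "B \<in> zero_sum_seqs G" "C \<in> zero_sum_seqs G" "B \<noteq> {#}" "C \<noteq> {#}"
      "A = B + C"
      using less.prems by (auto simp: zs_atoms_def)
    then have "size B < size A" "size C < size A" by (auto simp: nonempty_has_size)
    with BC less.hyps obtain Y Z where "set_mset Y \<subseteq> zs_atoms G" "\<Sum>\<^sub># Y = B"
      "set_mset Z \<subseteq> zs_atoms G" "\<Sum>\<^sub># Z = C" by metis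
    with BC show ?thesis by (intro exI[of _ "Y + Z"]) auto
  qed
qed

text \<open>The value that is set by hand for the empty sequence is the length of its empty factorization.\<close>
lemma length_set_iff:
  "k \<in> length_set G A \<longleftrightarrow> (\<exists>Y. set_mset Y \<subseteq> zs_atoms G \<and> size Y = k \<and> \<Sum>\<^sub># Y = A)"
proof (cases "A = {#}")
  case True
  have "Y = {#}" if "set_mset Y \<subseteq> zs_atoms G" "\<Sum>\<^sub># Y = {#}" for Y
    using that by (cases Y) (auto simp: zs_atoms_def)
  with True show ?thesis by (force simp: length_set_def)
next
  case False
  then show ?thesis
    by (auto simp: length_set_def nonempty_has_size intro!: Nat.gr0I)
qed

lemma length_setI:
  "set_mset Y \<subseteq> zs_atoms G \<Longrightarrow> \<Sum>\<^sub># Y = A \<Longrightarrow> size Y \<in> length_set G A"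
  by (auto simp: length_set_iff)

lemma length_set_zero_sum: "k \<in> length_set G A \<Longrightarrow> A \<in> zero_sum_seqs G"
  by (auto simp: length_set_iff intro!: zero_sum_of_atoms)

lemma length_set_nonempty: "A \<in> zero_sum_seqs G \<Longrightarrow> length_set G A \<noteq> {}"
  using ex_factorization length_setI by blast

lemma length_set_add:
  assumes "k \<in> length_set G A" "l \<in> length_set G B"
  shows "k + l \<in> length_set G (A + B)"
proof -
  obtain Y Z where "set_mset Y \<subseteq> zs_atoms G" "size Y = k" "\<Sum>\<^sub># Y = A"
    "set_mset Z \<subseteq> zs_atoms G" "size Z = l" "\<Sum>\<^sub># Z = B"
    using assms by (auto simp: length_set_iff)
  then show ?thesis
    by (auto simp: length_set_iff intro!: exI[of _ "Y + Z"])
qed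

lemma length_set_atom: "U \<in> zs_atoms G \<Longrightarrow> 1 \<in> length_set G U"
  using length_setI[of "{#U#}" U] by simp

lemma length_set_repeat:
  "k \<in> length_set G A \<Longrightarrow> m * k \<in> length_set G (repeat_mset m A)"
proof (induction m)
  case 0
  then show ?case by (simp add: length_set_def)
next
  case (Suc m)
  then show ?case using length_set_add[of k A "m * k" "repeat_mset m A"] by simp
qed

lemma length_set_le_size: "k \<in> length_set G A \<Longrightarrow> k \<le> size A"
proof -
  have "set_mset Y \<subseteq> zs_atoms G \<Longrightarrow> size Y \<le> size (\<Sum>\<^sub># Y)" for Y
  proof (induction Y)
    case (add U Y)
    then show ?case using zs_atomD(4)[of U] by auto
  qed auto
  then show "k \<in> length_set G A \<Longrightarrow> k \<le> size A" by (auto simp: length_set_iff)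
qed

lemma finite_length_set: "finite (length_set G A)"
  using length_set_le_size by (meson finite_nat_set_iff_bounded_le)

lemma length_set_pos: "k \<in> length_set G A \<Longrightarrow> A \<noteq> {#} \<Longrightarrow> 0 < k"
  by (auto simp: length_set_def)

lemma singleton_zero_sum_iff: "{#x#} \<in> zero_sum_seqs G \<longleftrightarrow> x = \<one>"
  using seq_sum_add_mset[of x "{#}"] by (auto simp: zero_sum_seqs_def)

lemma pair_zero_sum_iff:
  "{#x, y#} \<in> zero_sum_seqs G \<longleftrightarrow> x \<in> carrier G \<and> y = inv x"
  using inv_equality[of y x] m_comm[of x y]
  by (auto simp: zero_sum_seqs_def seq_sum_add_mset r_inv)

lemma atom_with_one:
  assumes "U \<in> zs_atoms G" "\<one> \<in># U"
  shows "U = {#\<one>#}"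
  using zs_atom_minimal[OF assms(1), of "{#\<one>#}"] assms(2) singleton_zero_sum_iff by auto

lemma pair_atom:
  assumes "x \<in> carrier G" "x \<noteq> \<one>"
  shows "{#x, inv x#} \<in> zs_atoms G"
  unfolding zs_atoms_iff
proof (intro conjI ballI impI)
  fix V assume V: "V \<in> zero_sum_seqs G" "V \<subseteq># {#x, inv x#}"
  have "inv x \<noteq> \<one>" using assms by (simp add: inv_eq_1_iff)
  have "size V \<le> 2" using size_mset_mono[OF V(2)] by simp
  moreover have "size V \<noteq> 1"
  proof
    assume "size V = 1"
    then obtain y where y: "V = {#y#}" using size_1_singleton_mset by blast
    then have "y \<in># {#x, inv x#}" using V(2) by (simp add: mset_subset_eqD)
    then show False using y V(1) assms \<open>inv x \<noteq> \<one>\<close> unfolding y singleton_zero_sum_iff by auto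
  qed
  ultimately have "size V = 0 \<or> size V = 2" by linarith
  then show "V = {#} \<or> V = {#x, inv x#}"
  proof
    assume "size V = 2"
    then show ?thesis using V(2) 
      by (metis mset_subset_size nat_neq_iff size_add_mset size_empty subset_mset.nless_le numeral_2_eq_2)
  qed auto
qed (use assms in \<open>auto simp: pair_zero_sum_iff\<close>)

lemma atom_of_pair:
  assumes "U \<in> zs_atoms G" "x \<in># U" "inv x \<in># U - {#x#}"
  shows "U = {#x, inv x#}"
proof -
  have "{#x, inv x#} \<subseteq># U"
    using assms(2,3) by (metis insert_DiffM mset_subset_eq_add_mset_cancel mset_subset_eq_single)
  then show ?thesis
    using zs_atom_minimal[OF assms(1), of "{#x, inv x#}"] zs_atomD(3)[OF assms(1)] assms(2)
    by (auto simp: pair_zero_sum_iff)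
qed

text \<open>
  An additive function that is 1 modulo \<open>d\<close> at every atom computes the length of every
  factorization modulo \<open>d\<close> from the product alone.
\<close>
lemma length_modulusI:
  fixes f :: "'a multiset \<Rightarrow> int"
  assumes "f {#} = 0"
    and add: "\<And>A B. A \<in> zero_sum_seqs G \<Longrightarrow> B \<in> zero_sum_seqs G \<Longrightarrow> set_mset A \<subseteq> X \<Longrightarrow> set_mset B \<subseteq> X \<Longrightarrow>
           f (A + B) = f A + f B"
    and atom: "\<And>U. U \<in> zs_atoms G \<Longrightarrow> set_mset U \<subseteq> X \<Longrightarrow> [f U = 1] (mod int d)"
  shows "length_modulus G X d"
proof -
  have *: "[f (\<Sum>\<^sub># Y) = int (size Y)] (mod int d)"
    if "set_mset Y \<subseteq> zs_atoms G" "set_mset (\<Sum>\<^sub># Y) \<subseteq> X" for Y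
    using that
  proof (induction Y)
    case (add U Y)
    then have "f (U + \<Sum>\<^sub># Y) = f U + f (\<Sum>\<^sub># Y)"
      by (intro assms(2)) (auto intro!: zero_sum_sum_mset dest: zs_atomD)
    then show ?case using add cong_add[OF atom[of U]] by simp
  qed (use assms in auto)
  show ?thesis
    unfolding length_modulus_def
  proof (intro ballI impI)
    fix B k l
    assume "B \<in> zero_sum_seqs G" "set_mset B \<subseteq> X" "k \<in> length_set G B" "l \<in> length_set G B"
    then obtain Y Z where "set_mset Y \<subseteq> zs_atoms G" "size Y = k" "\<Sum>\<^sub># Y = B"
      "set_mset Z \<subseteq> zs_atoms G" "size Z = l" "\<Sum>\<^sub># Z = B" "set_mset B \<subseteq> X"
      by (auto simp: length_set_iff)
    then have "[int k = int l] (mod int d)"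
      using *[of Y] *[of Z] by (metis cong_sym cong_trans)
    then show "[k = l] (mod d)" by (simp add: cong_int_iff)
  qed
qed

section \<open>The minimal distance of the powers of a sequence\<close>

lemma ex_distance_le:
  fixes L :: "nat set"
  assumes "x \<in> L" "y \<in> L" "x < y"
  shows "\<exists>e\<in>distances L. 0 < e \<and> e \<le> y - x"
proof -
  define z where "z = (LEAST z. z \<in> L \<and> x < z)"
  have z: "z \<in> L \<and> x < z" unfolding z_def by (rule LeastI[of _ y]) (use assms in auto)
  have "z \<le> w" if "w \<in> L" "x < w" for w
    unfolding z_def by (rule Least_le) (use that in auto)
  then have "z - x \<in> distances L" "z \<le> y"
    unfolding distances_def using z assms by (auto, metis leD)
  then show ?thesis using z by (intro bexI[of _ "z - x"]) auto
qed

lemma power_distancesE: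
  assumes "e \<in> power_distances G A"
  obtains k x where "x \<in> length_set G (repeat_mset k A)" "x + e \<in> length_set G (repeat_mset k A)" "0 < e"
proof -
  obtain k x y where "x \<in> length_set G (repeat_mset k A)" "y \<in> length_set G (repeat_mset k A)" "x < y" "e = y - x"
    using assms unfolding power_distances_def distances_def by blast
  then show ?thesis using that[of x k] by simp
qed

text \<open>
  The differences of lengths of powers of \<open>A\<close> form a subgroup of the integers, because
  \<open>L(A\<^sup>k) + L(A\<^sup>l) \<subseteq> L(A\<^sup>k\<^sup>+\<^sup>l)\<close>; its least positive element is attained by
  consecutive lengths, and it generates the subgroup.
\<close>
lemma min_power_distance_dvd:
  assumes A: "A \<in> zero_sum_seqs G" and ne: "power_distances G A \<noteq> {}"
  defines "d \<equiv> Inf (power_distances G A)"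
  assumes k: "x \<in> length_set G (repeat_mset k A)" "y \<in> length_set G (repeat_mset k A)"
  shows "int d dvd int x - int y"
proof -
  define D where "D = {int x - int y | x y k. x \<in> length_set G (repeat_mset k A) \<and> y \<in> length_set G (repeat_mset k A)}"
  have DI: "int x - int y \<in> D" if "x \<in> length_set G (repeat_mset k A)" "y \<in> length_set G (repeat_mset k A)" for x y k
    using that unfolding D_def by blast
  have Dadd: "a + b \<in> D" if ab: "a \<in> D" "b \<in> D" for a b
  proof -
    obtain x y k x' y' k' where *: "x \<in> length_set G (repeat_mset k A)" "y \<in> length_set G (repeat_mset k A)"
      "a = int x - int y" "x' \<in> length_set G (repeat_mset k' A)" "y' \<in> length_set G (repeat_mset k' A)"
      "b = int x' - int y'" using ab unfolding D_def by blast
    have "repeat_mset (k + k') A = repeat_mset k A + repeat_mset k' A"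
      by (rule repeat_mset_distrib) 
    then have "int (x + x') - int (y + y') \<in> D"
      using length_set_add[OF *(1,4)] length_set_add[OF *(2,5)] DI by metis
    moreover have "int (x + x') - int (y + y') = a + b" using * by simp
    ultimately show ?thesis by simp
  qed
  have Dneg: "- a \<in> D" if "a \<in> D" for a
    using that DI unfolding D_def by force
  have d: "d \<in> power_distances G A" unfolding d_def using ne by (rule Inf_nat_def1)
  then obtain j x0 where j: "x0 \<in> length_set G (repeat_mset j A)" "x0 + d \<in> length_set G (repeat_mset j A)" "0 < d"
    by (rule power_distancesE)
  then have dD: "int d \<in> D" using DI[OF j(2,1)] by simp
  have D0: "0 \<in> D" using DI[OF j(1,1)] by simp
  have mult: "int m * a \<in> D" if "a \<in> D" for m a
    by (induction m) (use D0 Dadd that in \<open>auto simp: algebra_simps\<close>)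
  have imult: "z * a \<in> D" if "a \<in> D" for z a
    using mult[OF that, of "nat \<bar>z\<bar>"] Dneg by (cases "z \<ge> 0") force+
  have least: "int d \<le> a" if "a \<in> D" and pos: "0 < a" for a
  proof -
    obtain x y k where *: "x \<in> length_set G (repeat_mset k A)" "y \<in> length_set G (repeat_mset k A)"
      "a = int x - int y" using \<open>a \<in> D\<close> unfolding D_def by blast
    then obtain e where "e \<in> distances (length_set G (repeat_mset k A))" "e \<le> x - y"
      using ex_distance_le[OF *(2,1)] pos by auto
    moreover from this have "e \<in> power_distances G A" unfolding power_distances_def by blast
    ultimately have "d \<le> x - y" unfolding d_def using cInf_lower[of e "power_distances G A"] by simp
    then show ?thesis using * pos by linarith
  qed
  have "(int x - int y) mod int d \<in> D"
    using Dadd[OF DI[OF k] imult[OF dD, of "- ((int x - int y) div int d)"]]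
    by (simp add: minus_div_mult_eq_mod)
  moreover have "(int x - int y) mod int d < int d" "(int x - int y) mod int d \<ge> 0"
    using j(3) by auto
  ultimately have "(int x - int y) mod int d = 0"
    using least by (metis linorder_not_le order_le_imp_less_or_eq)
  then show ?thesis by auto
qed

text \<open>
  Every zero-sum sequence over the support of \<open>A\<close> divides a power of \<open>A\<close>, so its differences of
  lengths also occur in that power.
\<close>
lemma length_modulus_min_power_distance:
  assumes A: "A \<in> zero_sum_seqs G" and ne: "power_distances G A \<noteq> {}"
  shows "length_modulus G (set_mset A) (Inf (power_distances G A))"
  unfolding length_modulus_def
proof (intro ballI impI)
  fix B k l
  assume B: "B \<in> zero_sum_seqs G" "set_mset B \<subseteq> set_mset A" "k \<in> length_set G B" "l \<in> length_set G B"
  let ?d = "Inf (power_distances G A)" and ?P = "repeat_mset (size B) A"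
  have "B \<subseteq># ?P"
  proof (rule mset_subset_eqI)
    fix a
    show "count B a \<le> count ?P a"
    proof (cases "a \<in># B")
      case True
      then have "1 \<le> count A a" using B(2) by (metis count_greater_eq_one_iff subsetD)
      then have "size B * 1 \<le> size B * count A a" by (intro mult_le_mono2)
      then show ?thesis using count_le_size[of B a]
        unfolding count_repeat_mset mult_1_right by (rule le_trans[rotated])
    qed (simp add: not_in_iff)
  qed
  then have P: "?P = B + (?P - B)" and "?P - B \<in> zero_sum_seqs G"
    using zero_sum_diff B zero_sum_repeat[OF A] by auto
  then obtain m where "m \<in> length_set G (?P - B)" using length_set_nonempty by blast
  then have "k + m \<in> length_set G ?P" "l + m \<in> length_set G ?P"
    using length_set_add B P by metis+
  from min_power_distance_dvd[OF A ne this] have "int ?d dvd int k - int l" by simp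
  then have "[int k = int l] (mod int ?d)" by (simp add: cong_iff_dvd_diff)
  then show "[k = l] (mod ?d)" by (simp add: cong_int_iff)
qed

lemma length_modulus_dvd_power_distance:
  assumes A: "A \<in> zero_sum_seqs G" and "length_modulus G (set_mset A) c" "e \<in> power_distances G A"
  shows "c dvd e"
proof -
  obtain k x where k: "x \<in> length_set G (repeat_mset k A)" "x + e \<in> length_set G (repeat_mset k A)"
    using power_distancesE[OF assms(3)] by blast
  have "set_mset (repeat_mset k A) \<subseteq> set_mset A" by (induction k) auto
  then have "[x + e = x] (mod c)"
    using assms(2) k zero_sum_repeat[OF A] by (intro length_modulusD[OF assms(2)]) auto
  then show ?thesis using cong_add_lcancel_0_nat cong_0_iff by blast
qed

section \<open>Sequences of maximal elasticity\<close>

text \<open>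
  The identity is an atom of length 1. Counting it twice below and \<open>n\<close> times above restores the
  bounds \<open>2\<close> and \<open>n\<close> for the length of an atom, with equality only for atoms of these lengths or for the
  identity.
\<close>
lemma size_bounds:
  assumes n: "2 \<le> n" and bd: "\<forall>U\<in>zs_atoms G. size U \<le> n"
    and Y: "set_mset Y \<subseteq> zs_atoms G"
  shows "2 * size Y \<le> size (\<Sum>\<^sub># Y) + count (\<Sum>\<^sub># Y) \<one>"
    and "size (\<Sum>\<^sub># Y) + (n - 1) * count (\<Sum>\<^sub># Y) \<one> \<le> n * size Y"
    and "2 * size Y = size (\<Sum>\<^sub># Y) + count (\<Sum>\<^sub># Y) \<one> \<Longrightarrow> U \<in># Y \<Longrightarrow> U = {#\<one>#} \<or> size U = 2"
    and "size (\<Sum>\<^sub># Y) + (n - 1) * count (\<Sum>\<^sub># Y) \<one> = n * size Y \<Longrightarrow> U \<in># Y \<Longrightarrow> U = {#\<one>#} \<or> size U = n"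
proof -
  have U: "U = {#\<one>#} \<or> (2 \<le> size U \<and> size U \<le> n \<and> count U \<one> = 0)" if U: "U \<in> zs_atoms G" for U
  proof (cases "\<one> \<in># U")
    case False
    have "size U \<noteq> 1"
      using False zs_atomD(1)[OF U] size_1_singleton_mset[of U] singleton_zero_sum_iff by auto
    then show ?thesis using False bd U zs_atomD(4)[OF U] by (auto simp: not_in_iff)
  qed (use atom_with_one U in auto)
  have all: "2 * size Y \<le> size (\<Sum>\<^sub># Y) + count (\<Sum>\<^sub># Y) \<one> \<and>
        size (\<Sum>\<^sub># Y) + (n - 1) * count (\<Sum>\<^sub># Y) \<one> \<le> n * size Y \<and>
        (2 * size Y = size (\<Sum>\<^sub># Y) + count (\<Sum>\<^sub># Y) \<one> \<longrightarrow> (\<forall>U\<in>#Y. U = {#\<one>#} \<or> size U = 2)) \<and>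
        (size (\<Sum>\<^sub># Y) + (n - 1) * count (\<Sum>\<^sub># Y) \<one> = n * size Y \<longrightarrow> (\<forall>U\<in>#Y. U = {#\<one>#} \<or> size U = n))"
    using Y
  proof (induction Y)
    case (add V Y)
    then have IH: "2 * size Y \<le> size (\<Sum>\<^sub># Y) + count (\<Sum>\<^sub># Y) \<one>"
        "size (\<Sum>\<^sub># Y) + (n - 1) * count (\<Sum>\<^sub># Y) \<one> \<le> n * size Y"
        "2 * size Y = size (\<Sum>\<^sub># Y) + count (\<Sum>\<^sub># Y) \<one> \<Longrightarrow> (\<forall>U\<in>#Y. U = {#\<one>#} \<or> size U = 2)"
        "size (\<Sum>\<^sub># Y) + (n - 1) * count (\<Sum>\<^sub># Y) \<one> = n * size Y \<Longrightarrow> (\<forall>U\<in>#Y. U = {#\<one>#} \<or> size U = n)"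
      by auto
    from U[of V] add.prems consider "V = {#\<one>#}" | "2 \<le> size V" "size V \<le> n" "count V \<one> = 0" by auto
    then show ?case
    proof cases
      case 1
      then show ?thesis using IH n by (cases n) (auto simp: algebra_simps)
    next
      case 2
      then show ?thesis using IH n by (cases n) (auto simp: algebra_simps)
    qed
  qed auto
  then show "2 * size Y \<le> size (\<Sum>\<^sub># Y) + count (\<Sum>\<^sub># Y) \<one>"
    and "size (\<Sum>\<^sub># Y) + (n - 1) * count (\<Sum>\<^sub># Y) \<one> \<le> n * size Y"
    and "2 * size Y = size (\<Sum>\<^sub># Y) + count (\<Sum>\<^sub># Y) \<one> \<Longrightarrow> U \<in># Y \<Longrightarrow> U = {#\<one>#} \<or> size U = 2"
    and "size (\<Sum>\<^sub># Y) + (n - 1) * count (\<Sum>\<^sub># Y) \<one> = n * size Y \<Longrightarrow> U \<in># Y \<Longrightarrow> U = {#\<one>#} \<or> size U = n"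
    by blast+
qed

text \<open>
  Each identity term adds 1 to every length, which keeps the elasticity below \<open>n / 2\<close>; so equality
  excludes such terms and makes both bounds for the size sharp.
\<close>
lemma Max_Min_length_set:
  assumes n: "3 \<le> n" and bd: "\<And>U. U \<in> zs_atoms G \<Longrightarrow> size U \<le> n" and A: "A \<in> zero_sum_seqs G"
  shows "2 * Max (length_set G A) \<le> n * Min (length_set G A)"
    and "2 * Max (length_set G A) = n * Min (length_set G A) \<Longrightarrow>
          \<exists>Y Z. set_mset Y \<subseteq> zs_atoms G \<and> \<Sum>\<^sub># Y = A \<and> (\<forall>U\<in>#Y. size U = n) \<and>
                set_mset Z \<subseteq> zs_atoms G \<and> \<Sum>\<^sub># Z = A \<and> (\<forall>U\<in>#Z. size U = 2)"
proof -
  let ?L = "length_set G A"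
  have "Min ?L \<in> ?L" "Max ?L \<in> ?L"
    using length_set_nonempty[OF A] finite_length_set by auto
  then obtain Y Z where Y: "set_mset Y \<subseteq> zs_atoms G" "\<Sum>\<^sub># Y = A" "size Y = Min ?L"
    and Z: "set_mset Z \<subseteq> zs_atoms G" "\<Sum>\<^sub># Z = A" "size Z = Max ?L"
    by (auto simp: length_set_iff)
  have n2: "2 \<le> n" using n by simp
  let ?z = "count A \<one>"
  have bd': "\<forall>U\<in>zs_atoms G. size U \<le> n" using bd by blast
  note b1 = size_bounds[OF n2 bd' Y(1), unfolded Y(2)] and b2 = size_bounds[OF n2 bd' Z(1), unfolded Z(2)]
  have "2 * ?z \<le> (n - 1) * ?z" by (rule mult_le_mono1) (use n in simp)
  then have z: "?z + ?z \<le> (n - 1) * ?z" unfolding mult_2 .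
  show le: "2 * Max ?L \<le> n * Min ?L"
    using b1(2) b2(1) z unfolding Y(3) Z(3) by linarith
  assume eq: "2 * Max ?L = n * Min ?L"
  have "n - 1 = Suc (n - 2)" using n by simp
  then have "?z + (n - 2) * ?z = (n - 1) * ?z" by simp
  then have "(n - 2) * ?z \<le> 0"
    using b1(2) b2(1) eq unfolding Y(3) Z(3) by linarith
  then have z0: "?z = 0" using n by auto
  have e1: "size A + (n - 1) * ?z = n * size Y" and e2: "2 * size Z = size A + ?z"
    using b1(2) b2(1) eq z0 unfolding Y(3) Z(3) by auto
  have "\<one> \<notin># A" using z0 by (simp add: not_in_iff)
  then have "\<forall>U\<in>#Y. \<one> \<notin># U" "\<forall>U\<in>#Z. \<one> \<notin># U"
    using Y(2) Z(2) in_Union_mset_iff by metis+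
  then have "size U = n" if "U \<in># Y" for U
    using b1(4)[OF e1 that] that by auto
  moreover have "size U = 2" if "U \<in># Z" for U
    using b2(3)[OF e2 that] that \<open>\<forall>U\<in>#Z. \<one> \<notin># U\<close> by auto
  ultimately show "\<exists>Y Z. set_mset Y \<subseteq> zs_atoms G \<and> \<Sum>\<^sub># Y = A \<and> (\<forall>U\<in>#Y. size U = n) \<and>
                set_mset Z \<subseteq> zs_atoms G \<and> \<Sum>\<^sub># Z = A \<and> (\<forall>U\<in>#Z. size U = 2)"
    using Y Z by blast
qed

lemma elasticity_eq_iff:
  assumes "3 \<le> n" "A \<in> zero_sum_seqs G"
  shows "elasticity (length_set G A) = real n / 2 \<longleftrightarrow>
         A \<noteq> {#} \<and> 2 * Max (length_set G A) = n * Min (length_set G A)"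
proof (cases "A = {#}")
  case True
  then show ?thesis using assms by (simp add: elasticity_def length_set_def)
next
  case False
  let ?L = "length_set G A"
  have "0 < Min ?L"
    using length_set_nonempty[OF assms(2)] finite_length_set False length_set_pos by (metis Min_in)
  moreover have "?L \<noteq> {0}" using False length_set_pos by blast
  ultimately have "elasticity ?L = real n / 2 \<longleftrightarrow> real (2 * Max ?L) = real (n * Min ?L)"
    by (auto simp: elasticity_def field_simps)
  then show ?thesis using False by (metis of_nat_eq_iff)
qed

lemma elasticity_le:
  assumes n: "3 \<le> n" and bd: "\<And>U. U \<in> zs_atoms G \<Longrightarrow> size U \<le> n" and A: "A \<in> zero_sum_seqs G"
  shows "elasticity (length_set G A) \<le> real n / 2"
proof (cases "A = {#}")
  case True
  then show ?thesis using assms by (simp add: elasticity_def length_set_def)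
next
  case False
  let ?L = "length_set G A"
  have "0 < Min ?L"
    using length_set_nonempty[OF A] finite_length_set False length_set_pos by (metis Min_in)
  moreover have "?L \<noteq> {0}" using False length_set_pos by blast
  moreover have "real (2 * Max ?L) \<le> real (n * Min ?L)"
    using Max_Min_length_set(1)[OF n bd A] of_nat_mono by blast
  ultimately show ?thesis
    by (auto simp: elasticity_def field_simps)
qed

lemma extremal_elasticity:
  assumes n: "3 \<le> n" and bd: "\<And>U. U \<in> zs_atoms G \<Longrightarrow> size U \<le> n" and "A \<noteq> {#}"
    and Y: "set_mset Y \<subseteq> zs_atoms G" "\<Sum>\<^sub># Y = A" "\<forall>U\<in>#Y. size U = n"
    and Z: "set_mset Z \<subseteq> zs_atoms G" "\<Sum>\<^sub># Z = A" "\<forall>U\<in>#Z. size U = 2"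
  shows "elasticity (length_set G A) = real n / 2"
proof -
  let ?L = "length_set G A"
  have A: "A \<in> zero_sum_seqs G" using zero_sum_of_atoms[OF Y(1)] Y(2) by simp
  have s: "size (\<Sum>\<^sub># Y) = m * size Y" if "\<forall>U\<in>#Y. size U = m" for Y :: "'a multiset multiset" and m
    using that by (induction Y) auto
  have "size Y \<in> ?L" "size Z \<in> ?L" using length_setI Y Z by blast+
  then have "Min ?L \<le> size Y" "size Z \<le> Max ?L" using finite_length_set by auto
  then have "n * Min ?L \<le> 2 * Max ?L"
    using s[OF Y(3)] s[OF Z(3)] Y(2) Z(2) by (metis mult_le_mono2 le_trans)
  then show ?thesis
    using Max_Min_length_set(1)[OF n bd A] elasticity_eq_iff[OF n A] \<open>A \<noteq> {#}\<close> by simp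
qed

end

section \<open>Minimal solutions of linear congruences\<close>

text \<open>
  Minimality refers to \<open>x\<close> and \<open>y\<close> only: for \<open>q > 0\<close> they determine \<open>z\<close>, and the difference
  of two comparable solutions is again a solution.
\<close>
definition min_sol :: "nat \<Rightarrow> nat \<Rightarrow> nat \<Rightarrow> nat \<Rightarrow> nat \<Rightarrow> bool" where
  "min_sol p q x y z \<longleftrightarrow> x + p * y = q * z \<and> (x, y) \<noteq> (0, 0) \<and>
     (\<forall>x' y' z'. x' + p * y' = q * z' \<and> x' \<le> x \<and> y' \<le> y \<longrightarrow>
        (x', y') = (0, 0) \<or> (x', y') = (x, y))"

text \<open>
  The pairs \<open>(a, n - a)\<close> and \<open>(n - a, a)\<close> describe the atoms over \<open>{g, -g, ag, -ag}\<close> with terms of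
  equal and of opposite sign. In suitable coordinates, the condition that all these atoms have height 1 modulo \<open>d\<close> takes the same form
  for both pairs, and this form is reproduced by the Euclidean algorithm.
\<close>
definition uniform :: "nat \<Rightarrow> nat \<Rightarrow> nat \<Rightarrow> bool" where
  "uniform d p q \<longleftrightarrow>
     (\<forall>x y z. min_sol p q x y z \<longrightarrow> [z = 1] (mod d) \<and> [x + y = 1] (mod d))"

lemma min_solD:
  assumes "min_sol p q x y z"
  shows "x + p * y = q * z" "(x, y) \<noteq> (0, 0)"
    "x' + p * y' = q * z' \<Longrightarrow> x' \<le> x \<Longrightarrow> y' \<le> y \<Longrightarrow> (x', y') = (0, 0) \<or> (x', y') = (x, y)"
  using assms unfolding min_sol_def by blast+

lemma min_solI:
  assumes "x + p * y = q * z" "(x, y) \<noteq> (0, 0)"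
    "\<And>x' y' z'. x' + p * y' = q * z' \<Longrightarrow> x' \<le> x \<Longrightarrow> y' \<le> y \<Longrightarrow> (x', y') = (0, 0) \<or> (x', y') = (x, y)"
  shows "min_sol p q x y z"
  using assms unfolding min_sol_def by blast

lemma uniformD:
  assumes "uniform d p q" "min_sol p q x y z"
  shows "[z = 1] (mod d)" "[x + y = 1] (mod d)"
  using assms unfolding uniform_def by blast+

text \<open>
  Reducing the multiplier modulo \<open>q\<close> only changes the coordinate \<open>z\<close>, which is determined by the
  other two, so this is a bijection of all minimal solutions.
\<close>
lemma min_sol_shift_multiplier:
  assumes "0 < q"
  shows "min_sol (c * q + r) q x y (z + c * y) \<longleftrightarrow> min_sol r q x y z"
proof -
  have eq: "x' + (c * q + r) * y' = q * (z' + c * y') \<longleftrightarrow> x' + r * y' = q * z'" for x' y' z'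
    by (auto simp: algebra_simps)
  have ge: "\<exists>w. z' = w + c * y'" if "x' + (c * q + r) * y' = q * z'" for x' y' z'
  proof -
    have "q * (c * y') \<le> q * z'" unfolding that[symmetric] by (simp add: algebra_simps)
    then show ?thesis using assms le_Suc_ex by (metis add.commute mult_le_cancel1)
  qed
  show ?thesis
  proof
    assume l: "min_sol (c * q + r) q x y (z + c * y)"
    show "min_sol r q x y z"
      by (rule min_solI) (use min_solD[OF l] eq in blast)+
  next
    assume r: "min_sol r q x y z"
    show "min_sol (c * q + r) q x y (z + c * y)"
      by (rule min_solI) (use min_solD[OF r] eq ge in \<open>blast | metis\<close>)+
  qed
qed

lemma min_sol_shift_multiplierE:
  assumes "0 < q" "min_sol (c * q + r) q x y Z"
  obtains z where "Z = z + c * y" "min_sol r q x y z"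
proof -
  have "q * (c * y) \<le> q * Z" unfolding min_solD(1)[OF assms(2), symmetric] by (simp add: algebra_simps)
  then have "c * y \<le> Z" using assms(1) by simp
  then obtain z where "Z = z + c * y" using le_Suc_ex by (metis add.commute)
  then show ?thesis using that min_sol_shift_multiplier assms by blast
qed

text \<open>
  Reducing the modulus modulo \<open>p\<close> identifies the solutions for \<open>r\<close> with those solutions for \<open>c p + r\<close>
  that satisfy \<open>c z \<le> y\<close>. A minimal solution stays minimal among all solutions, because a summand
  violating the inequality would have \<open>x > r\<close>, which puts the whole solution above \<open>(r, 0, 1)\<close>.
\<close>
lemma min_sol_shift_modulus:
  assumes "0 < p" "0 < r" "min_sol p r x y z"
  shows "min_sol p (c * p + r) x (y + c * z) z"
proof (rule min_solI)
  note m = min_solD[OF assms(3)]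
  show eq0: "x + p * (y + c * z) = (c * p + r) * z"
    using m(1) by (simp add: algebra_simps)
  show "(x, y + c * z) \<noteq> (0, 0)" using m(2) by auto
  have key: "c * z' \<le> y'" if eq: "x' + p * y' = (c * p + r) * z'" and x: "x' \<le> x" for x' y' z'
  proof (rule ccontr)
    assume "\<not> c * z' \<le> y'"
    then have less: "Suc y' \<le> c * z'" by simp
    then have "p * Suc y' \<le> p * (c * z')" by (rule mult_le_mono2)
    then have "r * z' + p \<le> x'" using eq by (simp add: algebra_simps)
    moreover have "0 < z'" using less by (intro Nat.gr0I) auto
    then have "r \<le> r * z'" by simp
    ultimately have "r < x" using x assms(1) by linarith
    then show False using m(3)[of r 0 1] assms(2) by auto
  qed
  fix x' y' z'
  assume *: "x' + p * y' = (c * p + r) * z'" "x' \<le> x" "y' \<le> y + c * z"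
  have "(c * p + r) * z' \<le> (c * p + r) * z"
    unfolding *(1)[symmetric] eq0[symmetric] using *(2,3) by (intro add_mono mult_le_mono2)
  then have z': "z' \<le> z" using assms(2) by simp
  have "(x - x') + p * (y + c * z - y') = (c * p + r) * (z - z')"
    using eq0 * by (simp add: diff_mult_distrib2)
  from key[OF this] have "c * (z - z') \<le> y + c * z - y'" by simp
  moreover have "c * z' \<le> c * z" using z' by simp
  ultimately have le: "y' - c * z' \<le> y"
    using *(3) unfolding diff_mult_distrib2 by linarith
  have ge: "c * z' \<le> y'" using key * by blast
  then have "x' + p * (y' - c * z') = r * z'"
    using *(1) by (simp add: diff_mult_distrib2 algebra_simps)
  from m(3)[OF this *(2) le] show "(x', y') = (0, 0) \<or> (x', y') = (x, y + c * z)"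
  proof
    assume "(x', y' - c * z') = (0, 0)"
    then show ?thesis using \<open>x' + p * (y' - c * z') = r * z'\<close> ge assms(2) by auto
  next
    assume e: "(x', y' - c * z') = (x, y)"
    then have "r * z' = r * z" using \<open>x' + p * (y' - c * z') = r * z'\<close> m(1) by force
    then have "z' = z" using assms(2) by simp
    then show ?thesis using e ge by auto
  qed
qed

text \<open>
  In the region \<open>y \<le> c z\<close> every solution is a sum of solutions with \<open>z = 1\<close>, so
  the only minimal ones there are \<open>(c p + r - p y, y, 1)\<close> with \<open>y \<le> c\<close>.
\<close>
lemma min_sol_shift_modulus_cases:
  assumes "0 < p" "0 < r" and m: "min_sol p (c * p + r) x y z"
  shows "(z = 1 \<and> y \<le> c) \<or> (\<exists>y'. y = y' + c * z \<and> min_sol p r x y' z)"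
proof (cases "y \<le> c * z")
  case True
  have z0: "z \<noteq> 0"
    using min_solD(1,2)[OF m] assms by (intro notI) auto
  \<comment> \<open>a solution with \<open>z = 1\<close> below the given one, which must therefore be equal to it\<close>
  define y1 where "y1 = min y c"
  define x1 where "x1 = c * p + r - p * y1"
  have pc: "p * y1 \<le> c * p" unfolding y1_def by (simp add: mult.commute)
  then have x1: "x1 + p * y1 = (c * p + r) * 1" "0 < x1"
    unfolding x1_def mult_1_right using assms(2) by linarith+
  have "y - y1 \<le> c * (z - 1)"
    unfolding y1_def using True z0 by (cases z) (auto simp: min_def)
  then have "p * (y - y1) \<le> p * (c * (z - 1))" by (rule mult_le_mono2)
  then have 1: "p * y \<le> p * y1 + p * (c * (z - 1))" unfolding y1_def by (simp add: diff_mult_distrib2)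
  have 2: "(c * p + r) * z = (c * p + r) + p * (c * (z - 1)) + r * (z - 1)"
    using z0 by (cases z) (auto simp: algebra_simps)
  define W where "W = p * (c * (z - 1))"
  have "x1 \<le> x"
    using 1 2 x1(1) min_solD(1)[OF m] unfolding W_def[symmetric] mult_1_right by linarith
  then have "(x1, y1) = (x, y)"
    using min_solD(3)[OF m x1(1)] x1(2) by (auto simp: y1_def)
  then have "(c * p + r) * 1 = (c * p + r) * z" "y \<le> c"
    using x1(1) min_solD(1)[OF m] by (auto simp: y1_def)
  then show ?thesis using assms(2) by auto
next
  case False
  then obtain y0 where y0: "y = y0 + c * z" by (metis add.commute le_Suc_ex nat_le_linear)
  have "min_sol p r x y0 z"
  proof (rule min_solI)
    show "x + p * y0 = r * z" using min_solD(1)[OF m] y0 by (simp add: algebra_simps)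
    then show "(x, y0) \<noteq> (0, 0)" using min_solD(2)[OF m] y0 assms by auto
    fix x' y' z' assume *: "x' + p * y' = r * z'" "x' \<le> x" "y' \<le> y0"
    have "r * z' \<le> r * z"
      unfolding *(1)[symmetric] \<open>x + p * y0 = r * z\<close>[symmetric]
      using *(2,3) by (intro add_mono mult_le_mono2)
    then have "z' \<le> z" using assms by simp
    then have "y' + c * z' \<le> y" unfolding y0 using *(3) by (intro add_mono mult_le_mono2)
    moreover have "x' + p * (y' + c * z') = (c * p + r) * z'" using *(1) by (simp add: algebra_simps)
    ultimately have "(x', y' + c * z') = (0, 0) \<or> (x', y' + c * z') = (x, y)"
      using min_solD(3)[OF m] *(2) by blast
    then show "(x', y') = (0, 0) \<or> (x', y') = (x, y0)"
    proof
      assume e: "(x', y' + c * z') = (x, y)"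
      then have "y0 \<le> y'" using y0 \<open>z' \<le> z\<close> 
        by (metis Pair_inject add_le_cancel_right add_mono_thms_linordered_semiring(2) mult_le_mono2)
      then show ?thesis using e *(3) by auto
    qed auto
  qed
  then show ?thesis using y0 by blast
qed

lemma min_sol_modulus: "0 < q \<Longrightarrow> min_sol p q q 0 1"
  by (rule min_solI) (auto simp: le_Suc_eq)

lemma min_sol_unit_modulus: "min_sol q 1 0 1 q"
  by (rule min_solI) (auto simp: le_Suc_eq)

lemma min_sol_complement: "0 < r \<Longrightarrow> r < p \<Longrightarrow> min_sol r p (p - r) 1 1"
proof (rule min_solI)
  fix x' y' z' assume r: "0 < r" "r < p" and *: "x' + r * y' = p * z'" "x' \<le> p - r" "y' \<le> 1"
  consider "y' = 0" | "y' = 1" using *(3) by linarith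
  then show "(x', y') = (0, 0) \<or> (x', y') = (p - r, 1)"
  proof cases
    case 1
    then have "x' = p * z'" using * by simp
    then have "p * z' < p * 1" using * r by linarith
    then show ?thesis using 1 * by simp
  next
    case 2
    then have "p * z' = x' + r" using * by simp
    then have "p * z' \<le> p * 1" "0 < p * z'" using * r by linarith+
    then have "z' = 1" by auto
    then show ?thesis using 2 * by auto
  qed
qed auto

lemma cong_add_multiple: "d dvd w \<Longrightarrow> [z + w = v] (mod d) \<longleftrightarrow> [z = v] (mod (d::nat))"
  by (auto simp: cong_def elim!: dvdE)

text \<open>The end of the Euclidean algorithm, where \<open>q\<close> is the last partial quotient.\<close>
lemma uniform_base: "0 < q \<Longrightarrow> uniform d 1 q \<and> uniform d q 1 \<longleftrightarrow> [q = 1] (mod d)"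
proof
  assume "0 < q" "uniform d 1 q \<and> uniform d q 1"
  then show "[q = 1] (mod d)" using uniformD(1)[of d q 1] min_sol_unit_modulus by blast
next
  assume q: "0 < q" "[q = 1] (mod d)"
  have "[z = 1] (mod d) \<and> [x + y = 1] (mod d)" if m: "min_sol 1 q x y z" for x y z
  proof -
    have z: "z \<noteq> 0" using min_solD(1,2)[OF m] by (intro notI) auto
    then have "q \<le> x + y" using min_solD(1)[OF m] by simp
    moreover define x1 where "x1 = min x q"
    ultimately have "x1 \<le> x" "q - x1 \<le> y" "x1 + 1 * (q - x1) = q * 1" by auto
    from min_solD(3)[OF m this(3,1,2)] have "x + y = q" using q(1) unfolding x1_def by auto
    then show ?thesis using min_solD(1)[OF m] q by simp
  qed
  moreover have "[z = 1] (mod d) \<and> [x + y = 1] (mod d)" if m: "min_sol q 1 x y z" for x y z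
  proof (cases "x = 0")
    case True
    then have "0 < y" using min_solD(2)[OF m] by auto
    then have "y = 1" using min_solD(3)[OF m, of 0 1 q] True by auto
    then show ?thesis using True min_solD(1)[OF m] q by simp
  next
    case False
    then have "x = 1 \<and> y = 0" using min_solD(3)[OF m, of 1 0 1] by auto
    then show ?thesis using min_solD(1)[OF m] by simp
  qed
  ultimately show "uniform d 1 q \<and> uniform d q 1" unfolding uniform_def by blast
qed

text \<open>
  That \<open>d\<close> divides \<open>c\<close> is forced by the minimal solution \<open>(p - r, 1, 1)\<close> for \<open>(r, p)\<close>, whose image
  for \<open>(c p + r, p)\<close> is \<open>(p - r, 1, 1 + c)\<close>; given this, the two reductions preserve the congruences.
\<close>
lemma uniform_step:
  assumes r: "0 < r" "r < p"
  shows "uniform d p (c * p + r) \<and> uniform d (c * p + r) p \<longleftrightarrow>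
         d dvd c \<and> uniform d p r \<and> uniform d r p" (is "?l \<longleftrightarrow> ?r")
proof
  have p: "0 < p" using r by simp
  {
    assume l: ?l
    have "min_sol (c * p + r) p (p - r) 1 (1 + c * 1)"
      using min_sol_complement[OF r] min_sol_shift_multiplier[OF p] by blast
    then have "[1 + c = 1] (mod d)" using l uniformD(1) by fastforce
    then have c: "d dvd c" using cong_add_lcancel_0_nat cong_0_iff by blast
    have "uniform d r p" unfolding uniform_def
    proof (intro allI impI)
      fix x y z assume "min_sol r p x y z"
      then have "min_sol (c * p + r) p x y (z + c * y)" using min_sol_shift_multiplier[OF p] by blast
      then have "[z + c * y = 1] (mod d)" "[x + y = 1] (mod d)" using l uniformD by blast+
      then show "[z = 1] (mod d) \<and> [x + y = 1] (mod d)" using c by (simp add: cong_add_multiple)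
    qed
    moreover have "uniform d p r" unfolding uniform_def
    proof (intro allI impI)
      fix x y z assume "min_sol p r x y z"
      then have "min_sol p (c * p + r) x (y + c * z) z" using min_sol_shift_modulus[OF p r(1)] by blast
      then have "[z = 1] (mod d)" "[(x + y) + c * z = 1] (mod d)" 
        using l uniformD by (metis add.assoc)+
      then show "[z = 1] (mod d) \<and> [x + y = 1] (mod d)" using c by (simp only: cong_add_multiple dvd_mult2)
    qed
    ultimately show ?r using c by blast
  }
  assume rr: ?r
  have r1: "[r = 1] (mod d)" using uniformD(2)[of d p r r 0 1] min_sol_modulus[OF r(1), of p] rr by simp
  have p1: "[p = 1] (mod d)" using uniformD(2)[of d r p p 0 1] min_sol_modulus[OF p, of r] rr by simp
  have q1: "[c * p + r = 1] (mod d)" using r1 rr cong_add_multiple[of d "c * p" r 1] by (simp add: add.commute)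
  have "uniform d (c * p + r) p" unfolding uniform_def
  proof (intro allI impI)
    fix x y z assume "min_sol (c * p + r) p x y z"
    then obtain z' where "z = z' + c * y" "min_sol r p x y z'" using min_sol_shift_multiplierE[OF p] by blast
    moreover from this have "[z' = 1] (mod d)" "[x + y = 1] (mod d)" using rr uniformD by blast+
    ultimately show "[z = 1] (mod d) \<and> [x + y = 1] (mod d)" using rr by (simp add: cong_add_multiple)
  qed
  moreover have "uniform d p (c * p + r)" unfolding uniform_def
  proof (intro allI impI)
    fix x y z assume m: "min_sol p (c * p + r) x y z"
    from min_sol_shift_modulus_cases[OF p r(1) m]
    show "[z = 1] (mod d) \<and> [x + y = 1] (mod d)"
    proof
      assume "z = 1 \<and> y \<le> c"
      moreover from this have "[x + p * y = 1] (mod d)" using min_solD(1)[OF m] q1 by simp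
      moreover have "[x + p * y = x + 1 * y] (mod d)" by (intro cong_add cong_mult cong_refl p1)
      ultimately show ?thesis using cong_trans cong_sym by (metis cong_refl mult_1)
    next
      assume "\<exists>y'. y = y' + c * z \<and> min_sol p r x y' z"
      then obtain y' where y': "y = y' + c * z" "min_sol p r x y' z" by blast
      then have "[z = 1] (mod d)" "[x + y' = 1] (mod d)" using rr uniformD by blast+
      moreover have "[(x + y') + c * z = 1] (mod d) \<longleftrightarrow> [x + y' = 1] (mod d)"
        using rr by (intro cong_add_multiple) auto
      ultimately show ?thesis using y'(1) by (simp add: add.assoc)
    qed
  qed
  ultimately show ?l by blast
qed

section \<open>The condition on continued fractions\<close>

lemma cfrac_value_gt_1:
  "as \<noteq> [] \<Longrightarrow> \<forall>a\<in>set as. 0 < a \<Longrightarrow> last as > 1 \<Longrightarrow> cfrac_value as > 1"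
proof (induction as rule: cfrac_value.induct)
  case (3 a b as)
  then have "cfrac_value (b # as) > 1" by simp
  then have "0 < 1 / cfrac_value (b # as)" by simp
  moreover have "(1::rat) \<le> of_nat a" using 3 by (simp add: Suc_leI)
  ultimately show ?case unfolding cfrac_value.simps by linarith
qed auto

lemma cfrac_tail:
  assumes v: "v > 1" and pq: "of_nat q / of_nat p = of_nat a + 1 / (v::rat)" and p: "0 < p"
  obtains r where "0 < r" "r < p" "q = a * p + r" "v = of_nat p / of_nat r"
proof -
  have e: "of_nat q = of_nat a * of_nat p + of_nat p / v"
    using pq p by (simp add: field_simps)
  have "0 < of_nat p / v" "of_nat p / v < of_nat p" using v p by (auto simp: field_simps)
  then have "of_nat (a * p) < (of_nat q :: rat)" using e by simp
  then have "a * p < q" by (simp only: of_nat_less_iff)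
  then obtain r where r: "q = a * p + r" "0 < r" using less_imp_add_positive by metis
  then have rv: "of_nat r = of_nat p / v" using e by simp
  then have "r < p" using \<open>of_nat p / v < of_nat p\<close> by (metis of_nat_less_iff)
  moreover have "v = of_nat p / of_nat r" using rv v p r(2) by (simp add: field_simps)
  ultimately show ?thesis using r that by blast
qed

lemma uniform_cfrac:
  assumes "as \<noteq> []" "\<forall>a\<in>set as. 0 < a" "last as > 1" "cfrac_value as = of_nat q / of_nat p"
    "coprime p q" "0 < p"
  shows "uniform d p q \<and> uniform d q p \<longleftrightarrow> (\<forall>a\<in>set (butlast as). d dvd a) \<and> [last as = 1] (mod d)"
  using assms
proof (induction as arbitrary: p q rule: cfrac_value.induct)
  case (2 a)
  have "of_nat q = (of_nat (a * p) :: rat)" using 2 by (simp add: field_simps)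
  then have "q = a * p" by (simp only: of_nat_eq_iff)
  then have "p = 1" using 2(5) by simp
  then show ?case using \<open>q = a * p\<close> uniform_base[of q d] 2 by auto
next
  case (3 a b as)
  have v: "cfrac_value (b # as) > 1" by (rule cfrac_value_gt_1) (use 3 in auto)
  from cfrac_tail[OF v, of q p a] 3(5,7) obtain r where
    r: "0 < r" "r < p" "q = a * p + r" "cfrac_value (b # as) = of_nat p / of_nat r"
    by auto
  have "coprime r p" using 3(6) unfolding r(3)
    by (metis coprime_commute coprime_iff_gcd_eq_1 gcd_add_mult mult.commute add.commute)
  then have "uniform d r p \<and> uniform d p r \<longleftrightarrow>
      (\<forall>a\<in>set (butlast (b # as)). d dvd a) \<and> [last (b # as) = 1] (mod d)"
    using 3 r by (intro "3.IH") auto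
  then show ?case unfolding r(3) uniform_step[OF r(1,2)] by auto
qed auto

lemma ex_cfrac:
  assumes "0 < p" "p < q" "coprime p q"
  shows "\<exists>as. is_regular_cfrac as (of_nat q / of_nat p)"
  using assms
proof (induction p arbitrary: q rule: less_induct)
  case (less p)
  show ?case
  proof (cases "p = 1")
    case True
    then show ?thesis using less by (intro exI[of _ "[q]"]) (auto simp: is_regular_cfrac_def)
  next
    case False
    let ?r = "q mod p" and ?c = "q div p"
    have r: "?r < p" using less by simp
    have "?r \<noteq> 0"
    proof
      assume "?r = 0"
      then have "p dvd q" by auto
      then show False using less.prems(3) False coprime_common_divisor[of p q p] by simp
    qed
    moreover have "coprime ?r p" using less by (simp add: coprime_commute)
    ultimately obtain as where as: "is_regular_cfrac as (of_nat p / of_nat ?r)"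
      using less.IH[OF r] r by blast
    then obtain b bs where b: "as = b # bs" unfolding is_regular_cfrac_def by (cases as) auto
    have c: "0 < ?c" using less by (simp add: div_greater_zero_iff)
    have "(of_nat q :: rat) = of_nat (?c * p + ?r)" by simp
    also have "\<dots> = of_nat ?c * of_nat p + of_nat ?r" by (simp only: of_nat_add of_nat_mult)
    finally have "of_nat q / of_nat p = (of_nat ?c + of_nat ?r / of_nat p :: rat)"
      using less by (simp add: field_simps)
    then have "is_regular_cfrac (?c # as) (of_nat q / of_nat p)"
      using as c unfolding is_regular_cfrac_def b by auto
    then show ?thesis by blast
  qed
qed

text \<open>
  Passing from \<open>n / a\<close> to \<open>(n - a) / a\<close> lowers the first partial quotient by one; after this
  the first and the middle entries are subject to the same condition.
\<close>
lemma dvd_cfrac_gcd_iff: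
  assumes as: "is_regular_cfrac as (of_nat n / of_nat a)" and a: "2 \<le> a" "a \<le> n div 2" "coprime a n"
  shows "d dvd cfrac_gcd as \<longleftrightarrow> uniform d a (n - a) \<and> uniform d (n - a) a"
    and "0 < cfrac_gcd as" "cfrac_gcd as < n - 2"
proof -
  have an: "2 * a \<le> n" using a by simp
  obtain a0 bs where as0: "as = a0 # bs" using as unfolding is_regular_cfrac_def by (cases as) auto
  have "bs \<noteq> []"
  proof
    assume "bs = []"
    then have "of_nat n = (of_nat (a0 * a) :: rat)" using as as0 a
      unfolding is_regular_cfrac_def by (simp add: field_simps)
    then have "n = a0 * a" by (simp only: of_nat_eq_iff)
    then show False using a by simp
  qed
  then obtain b cs where b: "as = a0 # b # cs" using as0 by (cases bs) auto
  have pos: "\<forall>x\<in>set (b # cs). 0 < x" and last: "last (b # cs) > 1"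
    using as unfolding is_regular_cfrac_def b by auto
  have v: "cfrac_value (b # cs) > 1" by (rule cfrac_value_gt_1) (use pos last in auto)
  have val: "of_nat n / of_nat a = of_nat a0 + 1 / cfrac_value (b # cs)"
    using as unfolding is_regular_cfrac_def b by simp
  obtain r where r: "0 < r" "r < a" "n = a0 * a + r"
    using cfrac_tail[OF v val] a by auto
  have a0: "2 \<le> a0"
  proof (rule ccontr)
    assume "\<not> 2 \<le> a0"
    then have "a0 * a \<le> 1 * a" by (intro mult_le_mono1) simp
    then show False using r an by linarith
  qed
  have "(of_nat (n - a) :: rat) = of_nat n - of_nat a" using an by (simp add: of_nat_diff)
  then have "of_nat (n - a) / of_nat a = of_nat n / of_nat a - (1::rat)" using a by (simp add: field_simps)
  then have val': "cfrac_value ((a0 - 1) # b # cs) = of_nat (n - a) / of_nat a"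
    using val a0 by (simp add: of_nat_diff)
  obtain k where k: "n = a + k" using an le_Suc_ex[of a n] by auto
  have "coprime a (n - a)" using a(3) unfolding k by (simp add: coprime_iff_gcd_eq_1)
  then have u: "uniform d a (n - a) \<and> uniform d (n - a) a \<longleftrightarrow>
      (\<forall>x\<in>set (butlast ((a0 - 1) # b # cs)). d dvd x) \<and> [last ((a0 - 1) # b # cs) = 1] (mod d)" for d
    using pos last a0 val' a by (intro uniform_cfrac) auto
  have mid: "{as ! i |i. 0 < i \<and> i < length as - 1} = set (butlast (b # cs))"
  proof -
    have "{as ! i |i. 0 < i \<and> i < length as - 1} = {(b # cs) ! i |i. i < length cs}"
    proof (intro equalityI subsetI)
      fix x assume "x \<in> {as ! i |i. 0 < i \<and> i < length as - 1}"
      then obtain i where "x = as ! i" "0 < i" "i < length as - 1" by blast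
      then show "x \<in> {(b # cs) ! i |i. i < length cs}" unfolding b by (cases i) auto
    next
      fix x assume "x \<in> {(b # cs) ! i |i. i < length cs}"
      then obtain i where "x = (b # cs) ! i" "i < length cs" by blast
      then have "x = as ! Suc i" "0 < Suc i" "Suc i < length as - 1" unfolding b by auto
      then show "x \<in> {as ! i |i. 0 < i \<and> i < length as - 1}" by blast
    qed
    also have "\<dots> = set (butlast (b # cs))"
      unfolding set_conv_nth by (rule Collect_cong) (metis length_butlast length_Cons diff_Suc_1 nth_butlast)
    finally show ?thesis .
  qed
  have g: "cfrac_gcd as = Gcd ({a0 - 1, last (b # cs) - 1} \<union> set (butlast (b # cs)))"
    unfolding cfrac_gcd_def mid by (simp add: b)
  have last_a: "[last ((a0 - 1) # b # cs) = 1] (mod d) \<longleftrightarrow> d dvd last (b # cs) - 1"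
    using last by (simp add: cong_altdef_nat)
  have bl: "set (butlast ((a0 - 1) # b # cs)) = insert (a0 - 1) (set (butlast (b # cs)))" by simp
  show "d dvd cfrac_gcd as \<longleftrightarrow> uniform d a (n - a) \<and> uniform d (n - a) a"
    unfolding u g dvd_Gcd_iff last_a bl by blast
  have "cfrac_gcd as dvd a0 - 1" unfolding g by (rule Gcd_dvd) simp
  then show "0 < cfrac_gcd as" using a0 by (intro Nat.gr0I) auto
  have "cfrac_gcd as \<le> a0 - 1" using \<open>cfrac_gcd as dvd a0 - 1\<close> a0 by (intro dvd_imp_le) auto
  moreover have "a0 * 2 \<le> a0 * a" using a by (intro mult_le_mono2)
  ultimately show "cfrac_gcd as < n - 2" using r a0 by linarith
qed

section \<open>Long atoms over a finite group\<close>

context comm_group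
begin

text \<open>Equal partial sums enclose a zero-sum segment, which in an atom is empty or everything.\<close>
lemma atom_segment:
  assumes U: "mset xs \<in> zs_atoms G" and ij: "i \<le> j" "j \<le> length xs"
    and eq: "seq_sum G (mset (take i xs)) = seq_sum G (mset (take j xs))"
  shows "i = j \<or> (i = 0 \<and> j = length xs)"
proof -
  let ?S = "mset (drop i (take j xs))"
  have app: "take j xs = take i xs @ drop i (take j xs)"
    using ij by (metis append_take_drop_id min.absorb1 take_take)
  have c: "set xs \<subseteq> carrier G" using zs_atomD(3)[OF U] by simp
  have ci: "set_mset (mset (take i xs)) \<subseteq> carrier G" and cS: "set_mset ?S \<subseteq> carrier G"
    using c set_take_subset set_drop_subset by (metis set_mset_mset subset_trans)+
  have "seq_sum G (mset (take j xs)) = seq_sum G (mset (take i xs)) \<otimes> seq_sum G ?S"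
    using seq_sum_union[OF ci cS] app by (metis mset_append)
  then have "seq_sum G ?S = \<one>"
    using eq seq_sum_closed[OF ci] seq_sum_closed[OF cS] by simp
  then have "?S \<in> zero_sum_seqs G" using cS by (simp add: zero_sum_seqs_def)
  moreover have "?S \<subseteq># mset xs"
  proof -
    have "mset xs = mset (take i xs) + ?S + mset (drop j xs)"
      by (metis app append_take_drop_id mset_append)
    then show ?thesis by (metis mset_subset_eq_add_right mset_subset_eq_add_left subset_mset.order_trans)
  qed
  ultimately have "?S = {#} \<or> ?S = mset xs" using zs_atom_minimal[OF U] by blast
  then show ?thesis
  proof
    assume "?S = {#}"
    then have "size ?S = 0" by simp
    then show ?thesis using ij by simp
  next
    assume "?S = mset xs"
    then have "size ?S = length xs" by simp
    then show ?thesis using ij by auto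
  qed
qed

lemma partial_sums_inj:
  assumes "mset xs \<in> zs_atoms G"
  shows "inj_on (\<lambda>i. seq_sum G (mset (take i xs))) {..<length xs}"
proof (rule linorder_inj_onI)
  fix i j assume "i < j" "i \<in> {..<length xs}" "j \<in> {..<length xs}"
  then show "seq_sum G (mset (take i xs)) \<noteq> seq_sum G (mset (take j xs))"
    using atom_segment[OF assms, of i j] by auto
qed auto

lemma partial_sums_carrier:
  assumes "mset xs \<in> zs_atoms G"
  shows "(\<lambda>i. seq_sum G (mset (take i xs))) ` {..<length xs} \<subseteq> carrier G"
proof -
  have "set xs \<subseteq> carrier G" using zs_atomD(3)[OF assms] by simp
  then have "seq_sum G (mset (take i xs)) \<in> carrier G" for i
    by (intro seq_sum_closed) (metis set_mset_mset set_take_subset subset_trans)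
  then show ?thesis by blast
qed

lemma size_atom_le_order:
  assumes "finite (carrier G)" "U \<in> zs_atoms G"
  shows "size U \<le> order G"
proof -
  obtain xs where xs: "U = mset xs" by (metis ex_mset)
  then show ?thesis
    using card_inj_on_le[OF partial_sums_inj partial_sums_carrier assms(1)] assms(2)
    by (simp add: order_def)
qed

lemma replicate_zero_sum_iff:
  "x \<in> carrier G \<Longrightarrow> replicate_mset k x \<in> zero_sum_seqs G \<longleftrightarrow> ord x dvd k"
  by (auto simp: zero_sum_seqs_def seq_sum_replicate pow_eq_id)

lemma replicate_ord_atom:
  assumes "x \<in> carrier G" "0 < ord x"
  shows "replicate_mset (ord x) x \<in> zs_atoms G"
  unfolding zs_atoms_iff
proof (intro conjI ballI impI)
  fix V assume "V \<in> zero_sum_seqs G" "V \<subseteq># replicate_mset (ord x) x"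
  moreover from this obtain k where "k \<le> ord x" "V = replicate_mset k x"
    by (auto elim: msubseteq_replicate_msetE)
  ultimately show "V = {#} \<or> V = replicate_mset (ord x) x"
    using assms by (auto simp: replicate_zero_sum_iff dest: dvd_imp_le)
qed (use assms in \<open>auto simp: replicate_zero_sum_iff\<close>)

text \<open>
  The partial sums of an atom of length \<open>|G|\<close>, in any order of its terms, run through the whole group.
  If \<open>x \<noteq> y\<close> are the first two terms, then \<open>y\<close> is itself a partial sum of at
  least the first two terms, and cancelling \<open>y\<close> leaves a shorter zero-sum sequence.
\<close>
lemma atom_of_order_length:
  assumes fin: "finite (carrier G)" and U: "U \<in> zs_atoms G" "size U = order G"
  shows "\<exists>x\<in>carrier G. ord x = order G \<and> U = replicate_mset (order G) x"
proof -
  have eq: "x = y" if xy: "x \<in># U" "y \<in># U" for x y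
  proof (rule ccontr)
    assume ne: "x \<noteq> y"
    then obtain V where V: "U = add_mset x (add_mset y V)"
      using xy by (metis add_mset_remove_trivial_eq insert_noteq_member mset_add)
    obtain zs where zs: "V = mset zs" by (metis ex_mset)
    let ?xs = "x # y # zs"
    have Ux: "mset ?xs = U" using V zs by simp
    let ?f = "\<lambda>i. seq_sum G (mset (take i ?xs))"
    have at: "mset ?xs \<in> zs_atoms G" using U(1) Ux by simp
    have len: "length ?xs = order G" using U(2) Ux by (metis size_mset)
    have c: "x \<in> carrier G" "y \<in> carrier G" "set zs \<subseteq> carrier G"
      using zs_atomD(3)[OF at] by auto
    have "card (?f ` {..<length ?xs}) = card (carrier G)"
      using card_image[OF partial_sums_inj[OF at]] len by (simp add: order_def)
    then have "?f ` {..<length ?xs} = carrier G"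
      using card_subset_eq[OF fin partial_sums_carrier[OF at]] by blast
    then have "y \<in> ?f ` {..<length ?xs}" using c(2) by (simp only:)
    then obtain i where i: "i < length ?xs" "?f i = y" by (elim imageE) (simp only: lessThan_iff)
    have y1: "y \<noteq> \<one>"
      using atom_with_one[OF U(1)] xy ne by auto
    consider "i = 0" | "i = 1" | j where "i = Suc (Suc j)"
      by (metis One_nat_def not0_implies_Suc)
    then show False
    proof cases
      case 1
      then show ?thesis using i(2) y1 by simp
    next
      case 2
      then show ?thesis using i(2) ne c seq_sum_add_mset[of x "{#}"] by simp
    next
      case 3
      let ?T = "mset (take j zs)"
      have cT: "set_mset ?T \<subseteq> carrier G" using c(3) set_take_subset by (metis set_mset_mset subset_trans)
      then have "y = x \<otimes> (y \<otimes> seq_sum G ?T)"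
        using i(2) c unfolding 3 by (simp add: seq_sum_add_mset)
      then have "y = y \<otimes> (x \<otimes> seq_sum G ?T)"
        using c cT by (simp add: m_lcomm)
      then have "x \<otimes> seq_sum G ?T = \<one>"
        using c(1,2) seq_sum_closed[OF cT] by simp
      then have "add_mset x ?T \<in> zero_sum_seqs G"
        using c cT by (simp add: zero_sum_seqs_def seq_sum_add_mset)
      moreover have "?T \<subseteq># mset zs" by (metis append_take_drop_id mset_append mset_subset_eq_add_left)
      then have "?T \<subseteq># add_mset y (mset zs)"
        by (rule subset_mset.order_trans) (rule mset_subset_eqI, simp)
      then have "add_mset x ?T \<subseteq># mset ?xs" by simp
      ultimately have "add_mset x ?T = {#} \<or> add_mset x ?T = mset ?xs"
        by (rule zs_atom_minimal[OF at])
      then have "size (add_mset x ?T) = 0 \<or> size (add_mset x ?T) = length ?xs"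
        by (metis size_mset size_empty)
      then show ?thesis using i(1) 3 by simp
    qed
  qed
  obtain x where x: "x \<in># U" using zs_atomD(2)[OF U(1)] by blast
  have "U = replicate_mset (order G) x"
    using set_mset_subset_singletonD[of U x] eq x U(2) by auto
  moreover have xc: "x \<in> carrier G" using x zs_atomD(3)[OF U(1)] by blast
  moreover have "ord x = order G"
  proof -
    have "ord x dvd order G" using ord_dvd_group_order[OF xc] .
    moreover have "0 < order G" using fin order_gt_0_iff_finite by blast
    ultimately have le: "ord x \<le> order G" "0 < ord x" by (auto intro: dvd_imp_le Nat.gr0I)
    then have "replicate_mset (ord x) x \<subseteq># U"
      using \<open>U = replicate_mset (order G) x\<close> by (auto intro!: mset_subset_eqI)
    then have "replicate_mset (ord x) x = U"
      using zs_atom_minimal[OF U(1)] zs_atomD(1)[OF replicate_ord_atom[OF xc le(2)]] le(2) by fastforce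
    then show ?thesis using U(2) by (metis size_replicate_mset)
  qed
  ultimately show ?thesis by blast
qed

end

section \<open>Sequences over a generator, a multiple of it and their negatives\<close>

locale generator_pair = comm_group +
  fixes g :: 'a and n a :: nat
  assumes g: "g \<in> carrier G" "ord g = n" and a: "2 \<le> a" "2 * a < n"
begin

definition h :: 'a where "h = g [^] a"

text \<open>The exponents belong to \<open>g\<close>, \<open>-g\<close>, \<open>h = ag\<close> and \<open>-h\<close>, in this order.\<close>
definition quad :: "nat \<Rightarrow> nat \<Rightarrow> nat \<Rightarrow> nat \<Rightarrow> 'a multiset" where
  "quad x x' y y' = replicate_mset x g + replicate_mset x' (inv g) +
     replicate_mset y h + replicate_mset y' (inv h)"

abbreviation four :: "'a set" where "four \<equiv> {g, inv g, h, inv h}"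

lemma h_closed [simp]: "h \<in> carrier G" using g by (simp add: h_def)

lemma four_carrier: "four \<subseteq> carrier G" using g by simp

lemma int_powers:
  "g = g [^] (1::int)" "inv g = g [^] (-1::int)" "h = g [^] int a" "inv h = g [^] (- int a)"
  using g by (simp_all add: h_def int_pow_int int_pow_neg int_pow_1)

lemma four_distinct: "g \<noteq> inv g" "g \<noteq> h" "g \<noteq> inv h" "inv g \<noteq> h" "inv g \<noteq> inv h" "h \<noteq> inv h"
proof -
  have *: "g [^] i \<noteq> g [^] j" if "0 < \<bar>i - j\<bar>" "\<bar>i - j\<bar> < int n" for i j :: int
  proof
    assume "g [^] i = g [^] j"
    then have "int n dvd j - i \<or> int n dvd i - j" using int_pow_eq[OF g(1), of i j] g(2) by blast
    then have "int n dvd \<bar>i - j\<bar>" by (metis dvd_abs_iff abs_minus_commute)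
    then show False using that zdvd_imp_le by fastforce
  qed
  have b: "int a \<ge> 2" "2 * int a < int n" using a by linarith+
  show "g \<noteq> inv g" "g \<noteq> h" "g \<noteq> inv h" "inv g \<noteq> h" "inv g \<noteq> inv h"
    by (subst int_powers(1) int_powers(2), subst int_powers(2) int_powers(3) int_powers(4), rule *; use b in linarith)+
  have "g [^] int a \<noteq> g [^] (- int a)" by (rule *) (use b in linarith)+
  then show "h \<noteq> inv h" using int_powers(3,4) by metis
qed

lemma count_quad [simp]:
  "count (quad x x' y y') g = x" "count (quad x x' y y') (inv g) = x'"
  "count (quad x x' y y') h = y" "count (quad x x' y y') (inv h) = y'"
  using four_distinct by (auto simp: quad_def)

lemma quad_add: "quad x x' y y' + quad u u' v v' = quad (x + u) (x' + u') (y + v) (y' + v')"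
  by (rule multiset_eqI) (simp add: quad_def)

lemma repeat_quad: "repeat_mset m (quad x x' y y') = quad (m * x) (m * x') (m * y) (m * y')"
  by (rule multiset_eqI) (simp add: quad_def distrib_left)

lemma set_quad: "set_mset (quad x x' y y') \<subseteq> four"
  by (auto simp: quad_def)

lemma quad_subset_iff:
  "quad x x' y y' \<subseteq># quad u u' v v' \<longleftrightarrow> x \<le> u \<and> x' \<le> u' \<and> y \<le> v \<and> y' \<le> v'"
proof
  assume "quad x x' y y' \<subseteq># quad u u' v v'"
  then have "count (quad x x' y y') e \<le> count (quad u u' v v') e" for e
    by (rule mset_subset_eq_count)
  from this[of g] this[of "inv g"] this[of h] this[of "inv h"]
  show "x \<le> u \<and> x' \<le> u' \<and> y \<le> v \<and> y' \<le> v'" by simp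
next
  assume *: "x \<le> u \<and> x' \<le> u' \<and> y \<le> v \<and> y' \<le> v'"
  show "quad x x' y y' \<subseteq># quad u u' v v'"
    unfolding quad_def by (intro subset_mset.add_mono) (use * in \<open>auto intro!: mset_subset_eqI\<close>)
qed

lemma quad_eq_iff:
  "quad x x' y y' = quad u u' v v' \<longleftrightarrow> x = u \<and> x' = u' \<and> y = v \<and> y' = v'"
  by (metis count_quad)

lemma quad_empty_iff: "quad x x' y y' = {#} \<longleftrightarrow> x = 0 \<and> x' = 0 \<and> y = 0 \<and> y' = 0"
  by (auto simp: quad_def)

lemma ex_quad:
  assumes "set_mset S \<subseteq> four"
  shows "S = quad (count S g) (count S (inv g)) (count S h) (count S (inv h))"
proof (rule multiset_eqI)
  fix e
  show "count S e = count (quad (count S g) (count S (inv g)) (count S h) (count S (inv h))) e"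
  proof (cases "e \<in> four")
    case True
    then show ?thesis by auto
  next
    case False
    then have "e \<notin># S" using assms by blast
    then show ?thesis using False set_quad by (metis not_in_iff subsetD)
  qed
qed

lemma quad_zero_sum_iff:
  "quad x x' y y' \<in> zero_sum_seqs G \<longleftrightarrow> int n dvd int x - int x' + int a * (int y - int y')"
proof -
  have hp: "h [^] k = g [^] (int a * int k)" for k :: nat
    by (metis h_def nat_pow_pow int_pow_int of_nat_mult g(1))
  have "seq_sum G (quad x x' y y') = g [^] x \<otimes> inv g [^] x' \<otimes> h [^] y \<otimes> inv h [^] y'"
    using g unfolding quad_def
    by (subst seq_sum_union | simp add: seq_sum_replicate)+
  also have "\<dots> = g [^] int x \<otimes> g [^] (- int x') \<otimes> g [^] (int a * int y) \<otimes> g [^] (- (int a * int y'))"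
    using g by (simp add: nat_pow_inv hp int_pow_neg int_pow_int)
  also have "\<dots> = g [^] (int x + - int x' + int a * int y + - (int a * int y'))"
    using g(1) by (simp only: int_pow_mult)
  also have "int x + - int x' + int a * int y + - (int a * int y') = int x - int x' + int a * (int y - int y')"
    by (simp add: algebra_simps)
  finally show ?thesis
    using g set_quad[of x x' y y'] four_carrier
    by (simp add: zero_sum_seqs_def int_pow_eq_id subset_trans)
qed

text \<open>
  Replacing \<open>g\<close> by \<open>-g\<close> exchanges the signs of all terms, so statements about \<open>quad x 0 y 0\<close> and
  \<open>quad x 0 0 y\<close> carry over to \<open>quad 0 x 0 y\<close> and \<open>quad 0 x y 0\<close>.
\<close>
lemma generator_pair_inv: "generator_pair G (inv g) n a"
  by unfold_locales (use g a in auto)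

lemma quad_inv: "generator_pair.quad G (inv g) a x x' y y' = quad x' x y' y"
proof -
  interpret i: generator_pair G "inv g" n a by (rule generator_pair_inv)
  have "i.h = inv h" using g by (simp add: i.h_def h_def nat_pow_inv)
  then show ?thesis using g by (simp add: i.quad_def quad_def add_ac)
qed

lemma same_sign_atom_iff: "quad x 0 y 0 \<in> zs_atoms G \<longleftrightarrow> (\<exists>k. min_sol a n x y k)"
proof
  have zs: "quad x 0 y 0 \<in> zero_sum_seqs G \<longleftrightarrow> (\<exists>k. x + a * y = n * k)" for x y
  proof -
    have "int x - int 0 + int a * (int y - int 0) = int (x + a * y)" by simp
    show ?thesis unfolding quad_zero_sum_iff \<open>int x - int 0 + int a * (int y - int 0) = int (x + a * y)\<close> int_dvd_int_iff
      by (simp add: dvd_def)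
  qed
  {
    assume U: "quad x 0 y 0 \<in> zs_atoms G"
    then obtain k where k: "x + a * y = n * k" using zs zs_atomD(1) by blast
    have "min_sol a n x y k"
    proof (rule min_solI)
      show "(x, y) \<noteq> (0, 0)" using zs_atomD(2)[OF U] by (auto simp: quad_empty_iff)
      fix x' y' z' assume "x' + a * y' = n * z'" "x' \<le> x" "y' \<le> y"
      then have "quad x' 0 y' 0 \<in> zero_sum_seqs G" "quad x' 0 y' 0 \<subseteq># quad x 0 y 0"
        using zs by (auto simp: quad_subset_iff)
      from zs_atom_minimal[OF U this] show "(x', y') = (0, 0) \<or> (x', y') = (x, y)"
        by (auto simp: quad_eq_iff quad_empty_iff)
    qed (rule k)
    then show "\<exists>k. min_sol a n x y k" ..
  }
  assume "\<exists>k. min_sol a n x y k"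
  then obtain k where m: "min_sol a n x y k" ..
  show "quad x 0 y 0 \<in> zs_atoms G"
    unfolding zs_atoms_iff
  proof (intro conjI ballI impI)
    fix V assume V: "V \<in> zero_sum_seqs G" "V \<subseteq># quad x 0 y 0"
    then have "set_mset V \<subseteq> four" using set_quad set_mset_mono by blast
    then obtain x1 x2 y1 y2 where Vq: "V = quad x1 x2 y1 y2" using ex_quad by blast
    then have le: "x1 \<le> x" "x2 = 0" "y1 \<le> y" "y2 = 0" using V(2) by (auto simp: quad_subset_iff)
    then obtain k1 where "x1 + a * y1 = n * k1" using V(1) Vq zs by auto
    from min_solD(3)[OF m this le(1,3)] show "V = {#} \<or> V = quad x 0 y 0"
      using Vq le by (auto simp: quad_empty_iff)
  qed (use zs min_solD(1,2)[OF m] in \<open>auto simp: quad_empty_iff\<close>)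
qed

lemma opposite_sign_zero_sum:
  "quad x 0 0 y \<in> zero_sum_seqs G \<longleftrightarrow> (\<exists>k. x + n * k = a * y) \<or> (\<exists>k. x = a * y + n * k)"
proof
  assume "quad x 0 0 y \<in> zero_sum_seqs G"
  then have "int n dvd int x - int (a * y)" by (simp add: quad_zero_sum_iff)
  then obtain k where k: "int x - int (a * y) = int n * k" by (elim dvdE)
  show "(\<exists>k. x + n * k = a * y) \<or> (\<exists>k. x = a * y + n * k)"
  proof (cases "0 \<le> k")
    case True
    then have "int x = int (a * y + n * nat k)" using k by simp
    then show ?thesis by (metis of_nat_eq_iff)
  next
    case False
    then have "int (x + n * nat (- k)) = int (a * y)" using k by simp
    then show ?thesis by (metis of_nat_eq_iff)
  qed
next
  assume "(\<exists>k. x + n * k = a * y) \<or> (\<exists>k. x = a * y + n * k)"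
  then have "int n dvd int x - int (a * y)"
  proof
    assume "\<exists>k. x + n * k = a * y"
    then obtain k where "a * y = x + n * k" by metis
    then show ?thesis by simp
  qed auto
  then show "quad x 0 0 y \<in> zero_sum_seqs G" by (simp add: quad_zero_sum_iff)
qed

text \<open>
  A sequence with terms of opposite sign may sum to any multiple of \<open>n\<close> of either sign. In a minimal
  solution \<open>x \<le> a < n\<close>, which excludes positive multiples for all divisors.
\<close>
lemma opposite_sign_atom:
  assumes m: "min_sol n a x k y"
  shows "quad x 0 0 y \<in> zs_atoms G"
  unfolding zs_atoms_iff
proof (intro conjI ballI impI)
  show "quad x 0 0 y \<in> zero_sum_seqs G" using min_solD(1)[OF m] opposite_sign_zero_sum by blast
  show "quad x 0 0 y \<noteq> {#}" using min_solD(1,2)[OF m] a by (auto simp: quad_empty_iff)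
  have xa: "x \<le> a"
    using min_solD(3)[OF m, of a 0 1] a by (cases "a \<le> x") auto
  fix V assume V: "V \<in> zero_sum_seqs G" "V \<subseteq># quad x 0 0 y"
  then have "set_mset V \<subseteq> four" using set_quad set_mset_mono by blast
  then obtain x1 x2 y1 y2 where "V = quad x1 x2 y1 y2" using ex_quad by blast
  with V(2) have Vq: "V = quad x1 0 0 y2" and le: "x1 \<le> x" "y2 \<le> y" by (auto simp: quad_subset_iff)
  have below: "\<exists>k. u + n * k = a * v" if "quad u 0 0 v \<in> zero_sum_seqs G" "u \<le> x" for u v
  proof -
    have "u < n" using that(2) xa a by linarith
    then have "k = 0" if "u = a * v + n * k" for k using that by (cases k) auto
    then show ?thesis using that(1) opposite_sign_zero_sum by force
  qed
  obtain k1 where k1: "x1 + n * k1 = a * y2" using below V(1) Vq le by blast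
  have "quad (x - x1) 0 0 (y - y2) \<in> zero_sum_seqs G"
  proof -
    have "quad x 0 0 y = V + quad (x - x1) 0 0 (y - y2)" using le by (simp add: Vq quad_add)
    then show ?thesis using zero_sum_cancel V(1) \<open>quad x 0 0 y \<in> zero_sum_seqs G\<close> by metis
  qed
  then obtain k2 where k2: "x - x1 + n * k2 = a * (y - y2)" using below by force
  have "a * y2 + a * (y - y2) = a * y" using le by (simp add: distrib_left[symmetric])
  then have "n * (k1 + k2) = n * k"
    using k1 k2 min_solD(1)[OF m] le unfolding distrib_left by linarith
  then have "k1 \<le> k" using a by simp
  from min_solD(3)[OF m k1 le(1) this]
  show "V = {#} \<or> V = quad x 0 0 y"
  proof
    assume "(x1, k1) = (0, 0)"
    then show ?thesis using k1 Vq a by (simp add: quad_empty_iff)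
  next
    assume "(x1, k1) = (x, k)"
    then have "a * y2 = a * y" using k1 min_solD(1)[OF m] by force
    then show ?thesis using Vq a \<open>(x1, k1) = (x, k)\<close> by simp
  qed
qed

text \<open>
  The solutions of \<open>x = a y + n k\<close> with \<open>k \<ge> 0\<close> are generated by \<open>g\<^sup>n\<close> and \<open>g\<^sup>a (-h)\<close>, which gives the two
  exceptional atoms.
\<close>
lemma opposite_sign_atom_cases:
  assumes U: "quad x 0 0 y \<in> zs_atoms G"
  shows "(x = n \<and> y = 0) \<or> (x = a \<and> y = 1) \<or> (\<exists>k. min_sol n a x k y)"
proof -
  have sub: "u = x \<and> v = y" if "\<exists>k. u + n * k = a * v \<or> u = a * v + n * k" "u \<le> x" "v \<le> y" "(u, v) \<noteq> (0, 0)" for u v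
  proof -
    have "quad u 0 0 v \<in> zero_sum_seqs G" using that(1) opposite_sign_zero_sum by blast
    then have "quad u 0 0 v = {#} \<or> quad u 0 0 v = quad x 0 0 y"
      using zs_atom_minimal[OF U] that by (auto simp: quad_subset_iff)
    then show ?thesis using that(4) by (auto simp: quad_eq_iff quad_empty_iff)
  qed
  have ne: "(x, y) \<noteq> (0, 0)" using zs_atomD(2)[OF U] by (auto simp: quad_empty_iff)
  from zs_atomD(1)[OF U, unfolded opposite_sign_zero_sum] show ?thesis
  proof
    assume "\<exists>k. x + n * k = a * y"
    then obtain k where k: "x + n * k = a * y" ..
    have "min_sol n a x k y"
    proof (rule min_solI)
      show "(x, k) \<noteq> (0, 0)" using ne k a by auto
      fix x' k' y' assume *: "x' + n * k' = a * y'" "x' \<le> x" "k' \<le> k"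
      then have "x' + n * k' \<le> x + n * k" by (intro add_mono mult_le_mono2)
      then have "y' \<le> y" unfolding k *(1) using a by simp
      show "(x', k') = (0, 0) \<or> (x', k') = (x, k)"
      proof (cases "(x', y') = (0, 0)")
        case True
        then show ?thesis using * a by auto
      next
        case False
        then have "x' = x \<and> y' = y" using sub * \<open>y' \<le> y\<close> by blast
        then have "n * k' = n * k" using k *(1) by (metis add_left_cancel)
        then show ?thesis using \<open>x' = x \<and> y' = y\<close> a by simp
      qed
    qed (rule k)
    then show ?thesis by blast
  next
    assume "\<exists>k. x = a * y + n * k"
    then obtain k where k: "x = a * y + n * k" ..
    show ?thesis
    proof (cases "y = 0")
      case True
      then have "n \<le> x" using k ne by (cases k) auto
      moreover have "\<exists>k. n + n * k = a * 0 \<or> n = a * 0 + n * k" by (rule exI[of _ 1]) simp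
      ultimately have "n = x \<and> 0 = y" using sub[of n 0] a by auto
      then show ?thesis by simp
    next
      case False
      then have "a \<le> x" using k by (cases y) auto
      moreover have "\<exists>k. a + n * k = a * 1 \<or> a = a * 1 + n * k" by (rule exI[of _ 0]) simp
      ultimately have "a = x \<and> 1 = y" using sub[of a 1] a False by auto
      then show ?thesis by simp
    qed
  qed
qed

lemma n_gt: "a < n" "0 < n" "0 < a" using a by linarith+

lemma same_sign_atom_inv_iff: "quad 0 x 0 y \<in> zs_atoms G \<longleftrightarrow> (\<exists>k. min_sol a n x y k)"
proof -
  interpret i: generator_pair G "inv g" n a by (rule generator_pair_inv)
  show ?thesis using i.same_sign_atom_iff unfolding quad_inv .
qed

lemma opposite_sign_atom_inv: "min_sol n a x k y \<Longrightarrow> quad 0 x y 0 \<in> zs_atoms G"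
proof -
  interpret i: generator_pair G "inv g" n a by (rule generator_pair_inv)
  show "min_sol n a x k y \<Longrightarrow> quad 0 x y 0 \<in> zs_atoms G" using i.opposite_sign_atom unfolding quad_inv .
qed

lemma opposite_sign_atom_inv_cases:
  assumes "quad 0 x y 0 \<in> zs_atoms G"
  shows "(x = n \<and> y = 0) \<or> (x = a \<and> y = 1) \<or> (\<exists>k. min_sol n a x k y)"
proof -
  interpret i: generator_pair G "inv g" n a by (rule generator_pair_inv)
  show ?thesis using i.opposite_sign_atom_cases assms unfolding quad_inv .
qed

lemma basic_atoms:
  "quad 1 1 0 0 \<in> zs_atoms G" "quad 0 0 1 1 \<in> zs_atoms G" "quad n 0 0 0 \<in> zs_atoms G"
  "quad 0 n 0 0 \<in> zs_atoms G" "quad a 0 0 1 \<in> zs_atoms G" "quad 0 a 1 0 \<in> zs_atoms G"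
proof -
  have "g \<noteq> \<one>" "h \<noteq> \<one>" using four_distinct g by auto
  then show "quad 1 1 0 0 \<in> zs_atoms G" "quad 0 0 1 1 \<in> zs_atoms G"
    using pair_atom[of g] pair_atom[of h] g by (simp_all add: quad_def add_mset_commute)
  show "quad n 0 0 0 \<in> zs_atoms G" "quad 0 n 0 0 \<in> zs_atoms G"
    using min_sol_modulus[of n a] n_gt same_sign_atom_iff same_sign_atom_inv_iff by blast+
  show "quad a 0 0 1 \<in> zs_atoms G" "quad 0 a 1 0 \<in> zs_atoms G"
    using min_sol_modulus[of a n] n_gt opposite_sign_atom opposite_sign_atom_inv by blast+
qed

lemma length_multiple:
  "quad x x' y y' \<in> zs_atoms G \<Longrightarrow> m \<in> length_set G (quad (m * x) (m * x') (m * y) (m * y'))"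
  using length_set_repeat[OF length_set_atom, of "quad x x' y y'" m] by (simp add: repeat_quad)

lemma modulusD:
  assumes M: "length_modulus G four d"
    and k: "k \<in> length_set G (quad x x' y y')" "l \<in> length_set G (quad u u' v v')"
    and eq: "x = u" "x' = u'" "y = v" "y' = v'"
  shows "[k = l] (mod d)"
  using length_modulusD[OF M length_set_zero_sum[OF k(1)] set_quad k(1)] k(2) eq by simp

text \<open>
  For \<open>U = g\<^sup>x h\<^sup>y\<close> with \<open>x + a y = n k\<close>, the two congruences compare the factorizations
  \<open>U (g\<^sup>a (-h))\<^sup>y = (g\<^sup>n)\<^sup>k (h (-h))\<^sup>y\<close> and \<open>U (-U) = (g (-g))\<^sup>x (h (-h))\<^sup>y\<close>.
\<close>
lemma same_sign_lengths:
  assumes M: "length_modulus G four d" and m: "min_sol a n x y k"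
  shows "[k = 1] (mod d)" "[x + y = 2] (mod d)"
proof -
  have U: "quad x 0 y 0 \<in> zs_atoms G" "quad 0 x 0 y \<in> zs_atoms G"
    using m same_sign_atom_iff same_sign_atom_inv_iff by blast+
  have "1 + y \<in> length_set G (quad (x + y * a) 0 y y)"
    using length_set_add[OF length_set_atom[OF U(1)] length_multiple[OF basic_atoms(5), of y]]
    by (simp add: quad_add)
  moreover have "k + y \<in> length_set G (quad (k * n) 0 y y)"
    using length_set_add[OF length_multiple[OF basic_atoms(3), of k] length_multiple[OF basic_atoms(2), of y]]
    by (simp add: quad_add)
  ultimately have "[1 + y = k + y] (mod d)"
    by (rule modulusD[OF M]) (use min_solD(1)[OF m] in \<open>simp_all add: mult.commute\<close>)
  then show "[k = 1] (mod d)" using cong_add_rcancel_nat cong_sym by blast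
  have "1 + 1 \<in> length_set G (quad x x y y)"
    using length_set_add[OF length_set_atom[OF U(1)] length_set_atom[OF U(2)]] by (simp add: quad_add)
  moreover have "x + y \<in> length_set G (quad x x y y)"
    using length_set_add[OF length_multiple[OF basic_atoms(1), of x] length_multiple[OF basic_atoms(2), of y]]
    by (simp add: quad_add)
  ultimately have "[1 + 1 = x + y] (mod d)" by (rule modulusD[OF M]) simp_all
  then show "[x + y = 2] (mod d)" by (simp add: cong_sym_eq numeral_2_eq_2)
qed

text \<open>
  For \<open>U = g\<^sup>x (-h)\<^sup>y\<close> with \<open>x + n k = a y\<close>, the first congruence comes from
  \<open>U ((-g)\<^sup>a h)\<^sup>y = (g (-g))\<^sup>x ((-g)\<^sup>n)\<^sup>k (h (-h))\<^sup>y\<close>.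
\<close>
lemma opposite_sign_lengths:
  assumes M: "length_modulus G four d" and m: "min_sol n a x k y"
  shows "[x + k = 1] (mod d)" "[x + y = 2] (mod d)"
proof -
  have U: "quad x 0 0 y \<in> zs_atoms G" "quad 0 x y 0 \<in> zs_atoms G"
    using m opposite_sign_atom opposite_sign_atom_inv by blast+
  have "1 + y \<in> length_set G (quad x (y * a) y y)"
    using length_set_add[OF length_set_atom[OF U(1)] length_multiple[OF basic_atoms(6), of y]]
    by (simp add: quad_add)
  moreover have "(x + k) + y \<in> length_set G (quad x (x + k * n) y y)"
    using length_set_add[OF length_set_add[OF length_multiple[OF basic_atoms(1), of x] 
        length_multiple[OF basic_atoms(4), of k]] length_multiple[OF basic_atoms(2), of y]]
    by (simp add: quad_add)
  ultimately have "[1 + y = (x + k) + y] (mod d)"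
    by (rule modulusD[OF M]) (use min_solD(1)[OF m] in \<open>simp_all add: mult.commute\<close>)
  then show "[x + k = 1] (mod d)" using cong_add_rcancel_nat cong_sym by blast
  have "1 + 1 \<in> length_set G (quad x x y y)"
    using length_set_add[OF length_set_atom[OF U(1)] length_set_atom[OF U(2)]] by (simp add: quad_add)
  moreover have "x + y \<in> length_set G (quad x x y y)"
    using length_set_add[OF length_multiple[OF basic_atoms(1), of x] length_multiple[OF basic_atoms(2), of y]]
    by (simp add: quad_add)
  ultimately have "[1 + 1 = x + y] (mod d)" by (rule modulusD[OF M]) simp_all
  then show "[x + y = 2] (mod d)" by (simp add: cong_sym_eq numeral_2_eq_2)
qed

text \<open>
  Replacing \<open>n\<close> by \<open>n - a\<close> is the reduction step with quotient 1. It turns the conditions on the atoms,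
  which differ for equal and opposite signs, into the common form \<open>uniform\<close>.
\<close>
lemma uniform_if_length_modulus:
  assumes M: "length_modulus G four d"
  shows "uniform d a (n - a)" "uniform d (n - a) a"
proof -
  have N: "1 * a + (n - a) = n" "0 < n - a" using n_gt by auto
  show "uniform d a (n - a)"
    unfolding uniform_def
  proof (intro allI impI)
    fix x y z assume "min_sol a (n - a) x y z"
    then have "min_sol a n x (y + z) z"
      using min_sol_shift_modulus[OF n_gt(3) N(2), of x y z 1] N(1) by simp
    from same_sign_lengths[OF M this] have "[z = 1] (mod d)" "[(x + y) + z = 1 + 1] (mod d)"
      by (simp_all add: add.assoc numeral_2_eq_2)
    then show "[z = 1] (mod d) \<and> [x + y = 1] (mod d)"
      by (metis cong_add_lcancel_nat cong_add_rcancel_nat cong_trans cong_sym)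
  qed
  show "uniform d (n - a) a"
    unfolding uniform_def
  proof (intro allI impI)
    fix x k y assume "min_sol (n - a) a x k y"
    then have "min_sol n a x k (y + k)"
      using min_sol_shift_multiplier[OF n_gt(3), of 1 "n - a" x k y] N(1) by simp
    from opposite_sign_lengths[OF M this] have "[x + k = 1] (mod d)" "[y + (x + k) = 1 + 1] (mod d)"
      by (simp_all add: add_ac numeral_2_eq_2)
    then show "[y = 1] (mod d) \<and> [x + k = 1] (mod d)"
      by (metis cong_add_lcancel_nat cong_add_rcancel_nat cong_trans cong_sym)
  qed
qed

text \<open>The coefficient of \<open>g\<close> in the sum of \<open>S\<close>, as an integer; zero-sum means divisible by \<open>n\<close>.\<close>
definition signed_sum :: "'a multiset \<Rightarrow> int" where
  "signed_sum S = int (count S g) - int (count S (inv g)) + int a * (int (count S h) - int (count S (inv h)))"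

text \<open>
  Modulo \<open>d\<close> this is the only additive function that can be 1 at \<open>g (-g)\<close>, \<open>h (-h)\<close>, \<open>g\<^sup>n\<close> and
  \<open>g\<^sup>a (-h)\<close>, because these four sequences generate the group of quotients of the zero-sum
  sequences over the four elements.
\<close>
definition height :: "'a multiset \<Rightarrow> int" where
  "height S = int (count S (inv g)) + int (count S (inv h)) + signed_sum S div int n"

lemma height_add:
  assumes "A \<in> zero_sum_seqs G" "set_mset A \<subseteq> four" "set_mset B \<subseteq> four"
  shows "height (A + B) = height A + height B"
proof -
  have "int n dvd signed_sum A"
    using assms(1) ex_quad[OF assms(2)] quad_zero_sum_iff unfolding signed_sum_def by metis
  then have "(signed_sum A + signed_sum B) div int n = signed_sum A div int n + signed_sum B div int n"
    by (rule div_plus_div_distrib_dvd_left)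
  moreover have "signed_sum (A + B) = signed_sum A + signed_sum B"
    by (simp add: signed_sum_def algebra_simps)
  ultimately show ?thesis by (simp add: height_def)
qed

lemma height_quad:
  "height (quad x x' y y') = int x' + int y' + (int x - int x' + int a * (int y - int y')) div int n"
  by (simp add: height_def signed_sum_def)

lemma same_sign_uniform:
  assumes U: "uniform d a (n - a)" "uniform d (n - a) a" and m: "min_sol a n x y k"
  shows "[k = 1] (mod d)" "[x + y = 2] (mod d)"
proof -
  have N: "1 * a + (n - a) = n" "0 < n - a" using n_gt by auto
  have a1: "[a = 1] (mod d)" using uniformD(2)[OF U(2) min_sol_modulus] n_gt by fastforce
  have N1: "[n - a = 1] (mod d)" using uniformD(2)[OF U(1) min_sol_modulus] N by fastforce
  have "(k = 1 \<and> y \<le> 1) \<or> (\<exists>y'. y = y' + 1 * k \<and> min_sol a (n - a) x y' k)"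
    using min_sol_shift_modulus_cases[OF n_gt(3) N(2), of 1] m N(1) by metis
  then have "[k = 1] (mod d) \<and> [x + y = 1 + 1] (mod d)"
  proof
    assume *: "k = 1 \<and> y \<le> 1"
    then consider "y = 0" | "y = 1" by linarith
    then have "[x + y = 1 + 1] (mod d)"
    proof cases
      case 1
      then have "x + y = a + (n - a)" using min_solD(1)[OF m] * N by simp
      then show ?thesis using cong_add[OF a1 N1] by simp
    next
      case 2
      then have "x + y = (n - a) + 1" using min_solD(1)[OF m] * N by simp
      then show ?thesis using cong_add[OF N1, of 1 1] by simp
    qed
    then show ?thesis using * by simp
  next
    assume "\<exists>y'. y = y' + 1 * k \<and> min_sol a (n - a) x y' k"
    then obtain y' where y': "y = y' + k" "min_sol a (n - a) x y' k" by auto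
    from uniformD[OF U(1) y'(2)] have "[k = 1] (mod d)" "[x + y' = 1] (mod d)" .
    then show ?thesis using y'(1) cong_add[of "x + y'" 1 d k 1] by (simp add: add.assoc)
  qed
  then show "[k = 1] (mod d)" "[x + y = 2] (mod d)" by (simp_all add: numeral_2_eq_2)
qed

lemma opposite_sign_uniform:
  assumes U: "uniform d (n - a) a" and m: "min_sol n a x k y"
  shows "[x + k = 1] (mod d)" "[int y - int k = 1] (mod int d)"
proof -
  have N: "1 * a + (n - a) = n" "0 < n - a" using n_gt by auto
  obtain y' where y': "y = y' + 1 * k" "min_sol (n - a) a x k y'"
    using min_sol_shift_multiplierE[OF n_gt(3), of 1 "n - a"] m N(1) by metis
  then show "[x + k = 1] (mod d)" using uniformD[OF U] by blast
  have "[y' = 1] (mod d)" using uniformD[OF U] y' by blast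
  then have "[int y' = int 1] (mod int d)" by (simp only: cong_int_iff)
  then show "[int y - int k = 1] (mod int d)" using y' by simp
qed

lemma length_modulus_if_uniform:
  assumes U: "uniform d a (n - a)" "uniform d (n - a) a"
  shows "length_modulus G four d"
proof (rule length_modulusI[of height])
  show "height {#} = 0" by (simp add: height_def signed_sum_def)
  show "height (A + B) = height A + height B"
    if "A \<in> zero_sum_seqs G" "B \<in> zero_sum_seqs G" "set_mset A \<subseteq> four" "set_mset B \<subseteq> four" for A B
    using that by (intro height_add)
  have N: "0 < n - a" using n_gt by auto
  have a1: "[a = 1] (mod d)" using uniformD(2)[OF U(2) min_sol_modulus] n_gt by fastforce
  have N1: "[n - a = 1] (mod d)" using uniformD(2)[OF U(1) min_sol_modulus] N by fastforce
  have n2: "[n = 1 + 1] (mod d)" using cong_add[OF a1 N1] n_gt by simp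
  have toint: "[int k = int l] (mod int d)" if "[k = l] (mod d)" for k l using that by (simp add: cong_int_iff)
  fix V assume V: "V \<in> zs_atoms G" "set_mset V \<subseteq> four"
  obtain x x' y y' where Vq: "V = quad x x' y y'" using ex_quad[OF V(2)] by blast
  show "[height V = 1] (mod int d)"
  proof (cases "0 < x \<and> 0 < x'")
    case True
    then have "quad 1 1 0 0 \<subseteq># V" unfolding Vq quad_subset_iff by simp
    then have "V = quad 1 1 0 0"
      using zs_atom_minimal[OF V(1)] zs_atomD(1,2)[OF basic_atoms(1)] by metis
    then show ?thesis by (simp add: height_quad)
  next
    case x: False
    show ?thesis
    proof (cases "0 < y \<and> 0 < y'")
      case True
      then have "quad 0 0 1 1 \<subseteq># V" unfolding Vq quad_subset_iff by simp
      then have "V = quad 0 0 1 1"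
        using zs_atom_minimal[OF V(1)] zs_atomD(1,2)[OF basic_atoms(2)] by metis
      then show ?thesis by (simp add: height_quad)
    next
      case False
      with x consider "x' = 0" "y' = 0" | "x = 0" "y = 0" | "x' = 0" "y = 0" | "x = 0" "y' = 0" by linarith
      then show ?thesis
      proof cases
        case 1
        then obtain k where m: "min_sol a n x y k" using V(1) Vq same_sign_atom_iff by blast
        have "int x + int a * int y = int n * int k"
          using min_solD(1)[OF m] by (metis of_nat_add of_nat_mult)
        then have "height V = int k" using 1 n_gt by (simp add: Vq height_quad)
        then show ?thesis using toint[OF same_sign_uniform(1)[OF U m]] by simp
      next
        case 2
        then obtain k where m: "min_sol a n x' y' k" using V(1) Vq same_sign_atom_inv_iff by blast
        have "int x' + int a * int y' = int n * int k"
          using min_solD(1)[OF m] by (metis of_nat_add of_nat_mult)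
        then have e: "- int x' - int a * int y' = int n * (- int k)" by (simp add: algebra_simps)
        have "(- int x' - int a * int y') div int n = - int k"
          unfolding e by (rule nonzero_mult_div_cancel_left) (use n_gt in simp)
        then have "height V = int (x' + y') - int k" using 2 by (simp add: Vq height_quad)
        moreover have "[int (x' + y') - int k = int 2 - int 1] (mod int d)"
          by (intro cong_diff toint same_sign_uniform[OF U m])
        ultimately show ?thesis by simp
      next
        case 3
        then have "(x = n \<and> y' = 0) \<or> (x = a \<and> y' = 1) \<or> (\<exists>k. min_sol n a x k y')"
          using V(1) Vq opposite_sign_atom_cases by blast
        then consider "x = n" "y' = 0" | "x = a" "y' = 1" | k where "min_sol n a x k y'" by blast
        then show ?thesis
        proof cases
          case 1
          then show ?thesis using 3 n_gt by (simp add: Vq height_quad)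
        next
          case 2
          then show ?thesis using 3 by (simp add: Vq height_quad)
        next
          case (3 k)
          have "int x + int n * int k = int a * int y'"
            using min_solD(1)[OF 3] by (metis of_nat_add of_nat_mult)
          then have e: "int x - int a * int y' = int n * (- int k)" by simp
          have "(int x - int a * int y') div int n = - int k"
            unfolding e by (rule nonzero_mult_div_cancel_left) (use n_gt in simp)
          then have "height V = int y' - int k" using \<open>x' = 0\<close> \<open>y = 0\<close> by (simp add: Vq height_quad)
          then show ?thesis using opposite_sign_uniform(2)[OF U(2) 3] by simp
        qed
      next
        case 4
        then have "(x' = n \<and> y = 0) \<or> (x' = a \<and> y = 1) \<or> (\<exists>k. min_sol n a x' k y)"
          using V(1) Vq opposite_sign_atom_inv_cases by blast
        then consider "x' = n" "y = 0" | "x' = a" "y = 1" | k where "min_sol n a x' k y" by blast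
        then show ?thesis
        proof cases
          case 1
          have "(- int n) div int n = - 1"
            using nonzero_mult_div_cancel_left[of "int n" "- 1"] n_gt by simp
          then have "height V = int n - int 1" using 1 4 n_gt by (simp add: Vq height_quad)
          moreover have "[int n - int 1 = int (1 + 1) - int 1] (mod int d)"
            by (intro cong_diff toint n2 cong_refl)
          ultimately show ?thesis by simp
        next
          case 2
          then show ?thesis using 4 toint[OF a1] by (simp add: Vq height_quad)
        next
          case (3 k)
          have "int x' + int n * int k = int a * int y"
            using min_solD(1)[OF 3] by (metis of_nat_add of_nat_mult)
          then have "- int x' + int a * int y = int n * int k" by simp
          then have "height V = int (x' + k)" using \<open>x = 0\<close> \<open>y' = 0\<close> n_gt by (simp add: Vq height_quad)
          then show ?thesis using toint[OF opposite_sign_uniform(1)[OF U(2) 3]] by simp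
        qed
      qed
    qed
  qed
qed

lemma length_modulus_single_pair: "length_modulus G {g, inv g} (n - 2)"
proof (rule length_modulusI[of height])
  show "height {#} = 0" by (simp add: height_def signed_sum_def)
  show "height (A + B) = height A + height B"
    if "A \<in> zero_sum_seqs G" "B \<in> zero_sum_seqs G" "set_mset A \<subseteq> {g, inv g}" "set_mset B \<subseteq> {g, inv g}" for A B
    using that by (intro height_add) auto
  fix V assume V: "V \<in> zs_atoms G" "set_mset V \<subseteq> {g, inv g}"
  then obtain x x' y y' where Vq: "V = quad x x' y y'" using ex_quad[of V] by blast
  have "h \<notin> {g, inv g}" "inv h \<notin> {g, inv g}" by (metis four_distinct insertE singletonD)+
  then have "h \<notin># V" "inv h \<notin># V" using V(2) by blast+
  then have y: "y = 0" "y' = 0" unfolding Vq by (simp_all add: count_eq_zero_iff[symmetric])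
  have sub: "V = W" if "W \<subseteq># V" "W \<in> zs_atoms G" for W
    using zs_atom_minimal[OF V(1)] zs_atomD(1,2)[OF that(2)] that(1) by metis
  consider "0 < x \<and> 0 < x'" | "x' = 0" | "x = 0" by linarith
  then show "[height V = 1] (mod int (n - 2))"
  proof cases
    case 1
    then have "quad 1 1 0 0 \<subseteq># V" unfolding Vq quad_subset_iff by simp
    then have "V = quad 1 1 0 0" using sub basic_atoms(1) by blast
    then show ?thesis by (simp add: height_quad)
  next
    case 2
    then have "int n dvd int x" "x \<noteq> 0"
      using zs_atomD(1,2)[OF V(1)] y by (auto simp: Vq quad_zero_sum_iff quad_empty_iff)
    then have "n \<le> x" by (simp add: dvd_imp_le)
    then have "quad n 0 0 0 \<subseteq># V" unfolding Vq quad_subset_iff by simp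
    then have "V = quad n 0 0 0" using sub basic_atoms(3) by blast
    then show ?thesis using n_gt by (simp add: height_quad)
  next
    case 3
    then have "int n dvd int x'" "x' \<noteq> 0"
      using zs_atomD(1,2)[OF V(1)] y by (auto simp: Vq quad_zero_sum_iff quad_empty_iff)
    then have "n \<le> x'" by (simp add: dvd_imp_le)
    then have "quad 0 n 0 0 \<subseteq># V" unfolding Vq quad_subset_iff by simp
    then have "V = quad 0 n 0 0" using sub basic_atoms(4) by blast
    moreover have "(- int n) div int n = - 1"
      using nonzero_mult_div_cancel_left[of "int n" "- 1"] n_gt by simp
    ultimately have "height V - 1 = int (n - 2)" using a by (simp add: height_quad of_nat_diff)
    then show ?thesis by (simp add: cong_iff_dvd_diff)
  qed
qed

text \<open>Compare the factorizations \<open>g\<^sup>n (-g)\<^sup>n = (g (-g))\<^sup>n\<close>.\<close>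
lemma length_modulus_dvd:
  assumes M: "length_modulus G {g, inv g} d"
  shows "d dvd n - 2"
proof -
  have "1 + 1 \<in> length_set G (quad n n 0 0)"
    using length_set_add[OF length_set_atom[OF basic_atoms(3)] length_set_atom[OF basic_atoms(4)]]
    by (simp add: quad_add)
  moreover have "n \<in> length_set G (quad n n 0 0)"
    using length_multiple[OF basic_atoms(1), of n] by simp
  moreover have "set_mset (quad n n 0 0) \<subseteq> {g, inv g}" by (auto simp: quad_def)
  ultimately have "[n = 1 + 1] (mod d)"
    using length_modulusD[OF M] length_set_zero_sum by blast
  then show ?thesis using a by (simp add: cong_altdef_nat numeral_2_eq_2)
qed

end

section \<open>Elementary 2-groups\<close>

locale two_group = comm_group +
  fixes r :: nat
  assumes square: "x \<in> carrier G \<Longrightarrow> x \<otimes> x = \<one>"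
    and order: "order G = 2 ^ r" and r: "2 \<le> r"
begin

lemma inv_self [simp]: "x \<in> carrier G \<Longrightarrow> inv x = x"
  using square inv_equality by blast

lemma fin: "finite (carrier G)"
  using order order_gt_0_iff_finite by simp

definition subset_sum :: "'a set \<Rightarrow> 'a" where
  "subset_sum K = seq_sum G (mset_set K)"

lemma finite_sub: "K \<subseteq> carrier G \<Longrightarrow> finite K"
  using fin finite_subset by blast

lemma subset_sum_closed [simp]: "K \<subseteq> carrier G \<Longrightarrow> subset_sum K \<in> carrier G"
  unfolding subset_sum_def using finite_sub by (intro seq_sum_closed) simp

lemma subset_sum_empty [simp]: "subset_sum {} = \<one>"
  by (simp add: subset_sum_def)

lemma subset_sum_singleton [simp]: "x \<in> carrier G \<Longrightarrow> subset_sum {x} = x"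
  using seq_sum_replicate[of x 1] by (simp add: subset_sum_def)

lemma subset_sum_disjoint:
  assumes "K \<subseteq> carrier G" "L \<subseteq> carrier G" "K \<inter> L = {}"
  shows "subset_sum (K \<union> L) = subset_sum K \<otimes> subset_sum L"
  using assms finite_sub by (simp add: subset_sum_def mset_set_Union seq_sum_union)

lemma subset_sum_sym_diff:
  assumes "K \<subseteq> carrier G" "L \<subseteq> carrier G"
  shows "subset_sum (sym_diff K L) = subset_sum K \<otimes> subset_sum L"
proof -
  let ?I = "K \<inter> L"
  have c: "K - L \<subseteq> carrier G" "L - K \<subseteq> carrier G" "?I \<subseteq> carrier G" using assms by auto
  have "subset_sum (K - L \<union> ?I) = subset_sum (K - L) \<otimes> subset_sum ?I"
    by (rule subset_sum_disjoint[OF c(1,3)]) blast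
  moreover have "subset_sum (L - K \<union> ?I) = subset_sum (L - K) \<otimes> subset_sum ?I"
    by (rule subset_sum_disjoint[OF c(2,3)]) blast
  moreover have "K - L \<union> ?I = K" "L - K \<union> ?I = L" by blast+
  moreover have "subset_sum (sym_diff K L) = subset_sum (K - L) \<otimes> subset_sum (L - K)"
    by (rule subset_sum_disjoint[OF c(1,2)]) auto
  moreover have "subset_sum ?I \<otimes> subset_sum ?I = \<one>" using c(3) by (simp add: square)
  ultimately have "subset_sum K \<otimes> subset_sum L =
      (subset_sum (K - L) \<otimes> subset_sum (L - K)) \<otimes> (subset_sum ?I \<otimes> subset_sum ?I)"
    using subset_sum_closed[OF c(1)] subset_sum_closed[OF c(2)] subset_sum_closed[OF c(3)]
    by (simp add: m_ac)
  then show ?thesis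
    using \<open>subset_sum (sym_diff K L) = _\<close> \<open>subset_sum ?I \<otimes> subset_sum ?I = \<one>\<close>
      subset_sum_closed[OF c(1)] subset_sum_closed[OF c(2)] by simp
qed

lemma mult_eq_one_iff:
  assumes "x \<in> carrier G" "y \<in> carrier G"
  shows "x \<otimes> y = \<one> \<longleftrightarrow> x = y"
  using assms square inv_self inv_equality by metis

lemma mset_set_zero_sum_iff:
  "K \<subseteq> carrier G \<Longrightarrow> mset_set K \<in> zero_sum_seqs G \<longleftrightarrow> subset_sum K = \<one>"
  using finite_sub by (auto simp: zero_sum_seqs_def subset_sum_def)

lemma square_atom:
  assumes "U \<in> zs_atoms G" "size U = 2"
  shows "\<exists>x\<in>carrier G. U = {#x, x#}"
proof -
  have "size U = Suc 1" using assms(2) by simp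
  then obtain x V where V: "U = add_mset x V" using size_eq_Suc_imp_eq_union by blast
  then have "size V = 1" using assms(2) by simp
  then obtain y where U: "U = {#x, y#}" using V size_1_singleton_mset by blast
  then have "x \<in> carrier G" "y = inv x" using zs_atomD(1)[OF assms(1)] by (auto simp: pair_zero_sum_iff)
  then show ?thesis using U by auto
qed

lemma squarefree_atom:
  assumes "U \<in> zs_atoms G" "size U \<noteq> 2"
  shows "U = mset_set (set_mset U)"
proof (rule multiset_eqI)
  fix x
  have "count U x \<le> 1"
  proof (rule ccontr)
    assume "\<not> count U x \<le> 1"
    then have "x \<in># U" "x \<in># U - {#x#}" by (auto simp: in_diff_count intro: count_inI)
    then have "U = {#x, inv x#}"
      using atom_of_pair[OF assms(1)] zs_atomD(3)[OF assms(1)] by (metis inv_self subsetD)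
    then have "size U = size {#x, inv x#}" by simp
    then show False using assms(2) by simp
  qed
  then show "count U x = count (mset_set (set_mset U)) x"
    by (cases "x \<in># U") (auto simp: not_in_iff le_Suc_eq simp flip: count_greater_zero_iff)
qed

text \<open>Atoms of length other than 2 are squarefree, so they are handled as sets.\<close>
definition atom_set :: "'a set \<Rightarrow> bool" where
  "atom_set E \<longleftrightarrow> mset_set E \<in> zs_atoms G \<and> E \<subseteq> carrier G"

lemma atom_setD:
  assumes "atom_set E"
  shows "E \<subseteq> carrier G" "finite E" "subset_sum E = \<one>" "E \<noteq> {}"
    "K \<subseteq> E \<Longrightarrow> subset_sum K = \<one> \<Longrightarrow> K = {} \<or> K = E"
proof -
  show c: "E \<subseteq> carrier G" and f: "finite E" using assms finite_sub by (auto simp: atom_set_def)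
  have at: "mset_set E \<in> zs_atoms G" using assms by (simp add: atom_set_def)
  show "subset_sum E = \<one>" using zs_atomD(1)[OF at] mset_set_zero_sum_iff c by blast
  show "E \<noteq> {}" using zs_atomD(2)[OF at] by auto
  assume K: "K \<subseteq> E" "subset_sum K = \<one>"
  then have "mset_set K \<in> zero_sum_seqs G" using mset_set_zero_sum_iff c by auto
  moreover have "mset_set K \<subseteq># mset_set E" using K f by (simp add: finite_subset subset_imp_msubset_mset_set)
  ultimately have "mset_set K = {#} \<or> mset_set K = mset_set E" using zs_atom_minimal[OF at] by blast
  then show "K = {} \<or> K = E" using K f finite_subset by (metis finite_set_mset_mset_set set_mset_empty)
qed

lemma atom_set_of_atom:
  assumes "U \<in> zs_atoms G" "size U \<noteq> 2"
  shows "atom_set (set_mset U)" "card (set_mset U) = size U" "mset_set (set_mset U) = U"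
  using squarefree_atom[OF assms] zs_atomD(3)[OF assms(1)] assms(1)
  by (simp_all add: atom_set_def) (metis size_mset_set)

lemma subset_sum_eqD:
  assumes E: "atom_set E" and K: "K \<subseteq> E" "L \<subseteq> E" "subset_sum K = subset_sum L"
  shows "K = L \<or> K = E - L"
proof -
  note c = atom_setD(1)[OF E]
  have "subset_sum (sym_diff K L) = \<one>"
    using subset_sum_sym_diff[of K L] K c square[of "subset_sum L"] by (metis subset_sum_closed subset_trans)
  moreover have "sym_diff K L \<subseteq> E" using K by blast
  ultimately have "sym_diff K L = {} \<or> sym_diff K L = E" using atom_setD(5)[OF E] by blast
  then show ?thesis using K by blast
qed

text \<open>
  Leaving out one element selects one set from each complementary pair; equal sums occur only within such
  pairs. So the subset sums of an atom of length \<open>r + 1\<close> exhaust a group of order \<open>2\<^sup>r\<close>.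
\<close>
lemma subset_sum_inj:
  assumes "atom_set E" "e \<in> E"
  shows "inj_on subset_sum (Pow (E - {e}))"
proof (rule inj_onI)
  fix K L assume *: "K \<in> Pow (E - {e})" "L \<in> Pow (E - {e})" "subset_sum K = subset_sum L"
  then have "K = L \<or> K = E - L" by (intro subset_sum_eqD[OF assms(1)]) auto
  then show "K = L" using * assms(2) by blast
qed

lemma card_atom_set_le:
  assumes "atom_set E"
  shows "card E \<le> Suc r"
proof -
  obtain e where e: "e \<in> E" using atom_setD(4)[OF assms] by blast
  have "subset_sum ` Pow (E - {e}) \<subseteq> carrier G"
    using atom_setD(1)[OF assms] by (auto intro!: subset_sum_closed)
  from card_inj_on_le[OF subset_sum_inj[OF assms e] this fin]
  have "(2::nat) ^ card (E - {e}) \<le> 2 ^ r"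
    using atom_setD(2)[OF assms] order by (simp add: card_Pow order_def)
  then have "card (E - {e}) \<le> r" by (rule power_le_imp_le_exp[rotated]) simp
  then show ?thesis using e atom_setD(2)[OF assms] by simp
qed

lemma subset_sum_surj:
  assumes "atom_set E" "card E = Suc r" "x \<in> carrier G"
  shows "\<exists>K\<subseteq>E. subset_sum K = x"
proof -
  obtain e where e: "e \<in> E" using atom_setD(4)[OF assms(1)] by blast
  have "subset_sum ` Pow (E - {e}) \<subseteq> carrier G"
    using atom_setD(1)[OF assms(1)] by (auto intro!: subset_sum_closed)
  moreover have "card (subset_sum ` Pow (E - {e})) = card (carrier G)"
    using card_image[OF subset_sum_inj[OF assms(1) e]] e assms(2) atom_setD(2)[OF assms(1)] order
    by (simp add: card_Pow order_def)
  ultimately have "subset_sum ` Pow (E - {e}) = carrier G" by (rule card_subset_eq[OF fin])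
  then have "x \<in> subset_sum ` Pow (E - {e})" using assms(3) by (simp only:)
  then obtain K where "K \<in> Pow (E - {e})" "x = subset_sum K" by (rule imageE)
  then show ?thesis by (intro exI[of _ K]) auto
qed

lemma subset_sum_complement:
  assumes "atom_set E" "K \<subseteq> E"
  shows "subset_sum (E - K) = subset_sum K"
proof -
  have "sym_diff E K = E - K" using assms(2) by blast
  moreover have Kc: "K \<subseteq> carrier G" using assms(2) atom_setD(1)[OF assms(1)] by (rule subset_trans)
  ultimately have "subset_sum (E - K) = \<one> \<otimes> subset_sum K"
    using subset_sum_sym_diff[OF atom_setD(1)[OF assms(1)] Kc] by (simp only: atom_setD(3)[OF assms(1)])
  then show ?thesis using subset_sum_closed[OF Kc] by (simp only: l_one)
qed

lemma size_atom_le: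
  assumes "U \<in> zs_atoms G"
  shows "size U \<le> Suc r"
proof (cases "size U = 2")
  case True
  then show ?thesis using r by simp
next
  case False
  then show ?thesis using card_atom_set_le atom_set_of_atom[OF assms] by metis
qed

text \<open>
  A term of \<open>F\<close> outside \<open>E\<close> is the sum of a subset of \<open>E\<close> and of its complement. Take such a subset \<open>I\<close> of
  least size. If no other subset \<open>J\<close> of this kind crosses \<open>I\<close>, minimality forces \<open>I \<inter> J = {}\<close>
  or \<open>I \<subseteq> J\<close>. Then, writing sums over \<open>F\<close> as sums over \<open>E\<close>, only the terms of \<open>F\<close> in
  \<open>I\<close> influence the part inside \<open>I\<close>, up to complement. As \<open>F\<close> sums to zero, it contains all of \<open>I\<close> or
  nothing of it. In the first case the sum of \<open>I\<close> and the set \<open>I\<close> itself form a zero-sum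
  subset of \<open>F\<close> that is too small to be \<open>F\<close>; in the second, no element of \<open>I\<close> is a sum over \<open>F\<close>.
\<close>
lemma ex_crossing:
  assumes E: "atom_set E" "card E = Suc r" and F: "atom_set F" "card F = Suc r" and "E \<noteq> F"
  shows "\<exists>I J. I \<subseteq> E \<and> J \<subseteq> E \<and> subset_sum I \<in> F - E \<and> subset_sum J \<in> F - E \<and>
           I \<inter> J \<noteq> {} \<and> I - J \<noteq> {} \<and> J - I \<noteq> {} \<and> E - (I \<union> J) \<noteq> {}"
proof (rule ccontr)
  assume no: "\<not> ?thesis"
  note cE = atom_setD(1)[OF E(1)] and cF = atom_setD(1)[OF F(1)]
  have ssc: "subset_sum K \<in> carrier G" if "K \<subseteq> E" for K using that cE by (intro subset_sum_closed) auto
  define C where "C = {I. I \<subseteq> E \<and> subset_sum I \<in> F - E}"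
  have "\<not> F \<subseteq> E" using E F \<open>E \<noteq> F\<close> atom_setD(2) card_subset_eq by metis
  then obtain f where "f \<in> F - E" by blast
  moreover from this obtain K where "K \<subseteq> E" "subset_sum K = f" using subset_sum_surj[OF E, of f] cF by blast
  ultimately have "K \<in> C" unfolding C_def by simp
  then obtain I where I: "I \<in> C" and least: "\<And>J. J \<in> C \<Longrightarrow> card I \<le> card J"
    using ex_has_least_nat[of "\<lambda>K. K \<in> C" K card] by blast
  have IE: "I \<subseteq> E" "subset_sum I \<in> F" "subset_sum I \<notin> E" using I unfolding C_def by auto
  have finI: "finite I" using IE(1) atom_setD(2)[OF E(1)] finite_subset by blast
  have compl: "E - J \<in> C" if "J \<in> C" for J
    using that subset_sum_complement[OF E(1), of J] unfolding C_def by auto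
  have laminar: "I \<inter> J = {} \<or> I \<subseteq> J" if J: "J \<in> C" for J
  proof -
    have JE: "J \<subseteq> E" using J unfolding C_def by blast
    have finJ: "finite J" using JE atom_setD(2)[OF E(1)] finite_subset by blast
    have "I \<inter> J = {} \<or> I - J = {} \<or> J - I = {} \<or> E - (I \<union> J) = {}"
      using no I J unfolding C_def by blast
    moreover have "J = I" if "J - I = {}"
      using that least[OF J] finI by (metis Diff_eq_empty_iff card_seteq)
    moreover have "E - J = I" if "E - (I \<union> J) = {}"
    proof -
      have "E - J \<subseteq> I" using that by blast
      then show ?thesis using least[OF compl[OF J]] finI by (metis card_seteq)
    qed
    ultimately show ?thesis by blast
  qed
  have "\<one> \<notin> F"
  proof
    assume "\<one> \<in> F"
    then have "{\<one>} = F" using atom_setD(5)[OF F(1), of "{\<one>}"] by simp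
    then have "card F = 1" by auto
    then show False using F(2) r by simp
  qed
  then have "I \<noteq> {}" using IE(2) by auto
  moreover have "card I \<noteq> 1"
  proof
    assume "card I = 1"
    then obtain e where "I = {e}" by (metis card_1_singletonE)
    then show False using IE cE by auto
  qed
  ultimately have I2: "2 \<le> card I" using finI by (metis One_nat_def Suc_leI card_gt_0_iff le_neq_implies_less one_add_one plus_1_eq_Suc)
  have EI2: "2 \<le> card (E - I)" using least[OF compl[OF I]] I2 by linarith
  have trace: "\<exists>J\<subseteq>E. subset_sum F' = subset_sum J \<and> (J \<inter> I = F' \<inter> I \<or> J \<inter> I = I - F')"
    if "F' \<subseteq> F" for F'
  proof -
    have "finite F'" using that atom_setD(2)[OF F(1)] finite_subset by blast
    then show ?thesis using that
    proof (induction F')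
      case empty
      then show ?case by (intro exI[of _ "{}"]) auto
    next
      case (insert x F')
      then obtain J where J: "J \<subseteq> E" "subset_sum F' = subset_sum J" "J \<inter> I = F' \<inter> I \<or> J \<inter> I = I - F'"
        by auto
      have xc: "x \<in> carrier G" using insert cF by blast
      obtain X where X: "X \<subseteq> E" "subset_sum X = x" "X \<inter> I = {x} \<inter> I \<or> X \<inter> I = I - {x}"
      proof (cases "x \<in> E")
        case True
        then show ?thesis using that[of "{x}"] xc by auto
      next
        case False
        obtain X where X: "X \<subseteq> E" "subset_sum X = x" using subset_sum_surj[OF E xc] by blast
        then have "X \<in> C" using insert.prems False unfolding C_def by simp
        then show ?thesis using that[OF X] laminar[of X] False IE(1) by blast
      qed
      have JX: "sym_diff J X \<subseteq> E" using J X by blast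
      have "subset_sum (insert x F') = subset_sum {x} \<otimes> subset_sum F'"
        using subset_sum_disjoint[of "{x}" F'] insert xc cF by auto
      also have "\<dots> = subset_sum J \<otimes> subset_sum X"
        using J X xc ssc by (simp add: m_comm)
      also have "\<dots> = subset_sum (sym_diff J X)"
        using subset_sum_sym_diff[of J X] J X cE by auto
      finally have "subset_sum (insert x F') = subset_sum (sym_diff J X)" .
      moreover have "sym_diff J X \<inter> I = insert x F' \<inter> I \<or> sym_diff J X \<inter> I = I - insert x F'"
      proof -
        have "sym_diff J X \<inter> I = sym_diff (J \<inter> I) (X \<inter> I)" by blast
        with J(3) X(3) insert.hyps(2) show ?thesis
          by (elim disjE; simp only:; blast)
      qed
      ultimately show ?case using JX by blast
    qed
  qed
  have "F \<inter> I = {} \<or> I \<subseteq> F"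
  proof -
    obtain J where J: "J \<subseteq> E" "subset_sum F = subset_sum J" "J \<inter> I = F \<inter> I \<or> J \<inter> I = I - F"
      using trace[of F] by blast
    then have "J = {} \<or> J = E" using atom_setD(5)[OF E(1) J(1)] atom_setD(3)[OF F(1)] by simp
    then show ?thesis using J(3) IE(1) by blast
  qed
  then show False
  proof
    assume IF: "I \<subseteq> F"
    let ?f = "subset_sum I"
    have fI: "?f \<notin> I" using IE by blast
    have "subset_sum (insert ?f I) = subset_sum {?f} \<otimes> subset_sum I"
      using subset_sum_disjoint[of "{?f}" I] fI IE(1) cE ssc by auto
    then have "subset_sum (insert ?f I) = \<one>" using ssc[OF IE(1)] square by simp
    then have "insert ?f I = F" using atom_setD(5)[OF F(1), of "insert ?f I"] IF IE(2) by auto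
    then have "card F = Suc (card I)" using fI finI by (metis card_insert_disjoint)
    then have "card (E - I) = 1" using E(2) F(2) IE(1) finI by (simp add: card_Diff_subset)
    then show False using EI2 by simp
  next
    assume disj: "F \<inter> I = {}"
    obtain e where e: "e \<in> I" using \<open>I \<noteq> {}\<close> by blast
    then have ec: "e \<in> carrier G" using IE(1) cE by blast
    obtain F' where F': "F' \<subseteq> F" "subset_sum F' = e" using subset_sum_surj[OF F ec] by blast
    obtain J where J: "J \<subseteq> E" "subset_sum F' = subset_sum J" "J \<inter> I = F' \<inter> I \<or> J \<inter> I = I - F'"
      using trace[OF F'(1)] by blast
    have "subset_sum J = subset_sum {e}" using J F' ec by simp
    then have "J = {e} \<or> J = E - {e}" using subset_sum_eqD[OF E(1) J(1)] e IE(1) by blast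
    moreover have "I \<noteq> {e}" using I2 by auto
    ultimately show False using J(3) F'(1) disj e IE(1) by blast
  qed
qed

text \<open>
  A zero-sum subsequence containing exactly one of the two new terms would make it the sum of a subset
  of \<open>D\<close>; but the only subsets of \<open>E\<close> with these sums are \<open>I\<close>, \<open>J\<close> and their complements.
\<close>
lemma atom_set_extend:
  assumes E: "atom_set E" and I: "I \<subseteq> E" "subset_sum I \<notin> E" and J: "J \<subseteq> E" "subset_sum J \<notin> E"
    and ne: "subset_sum I \<noteq> subset_sum J"
    and D: "D \<subseteq> E" "subset_sum D = subset_sum I \<otimes> subset_sum J"
    and not_sub: "\<not> I \<subseteq> D" "\<not> E - I \<subseteq> D" "\<not> J \<subseteq> D" "\<not> E - J \<subseteq> D"
  shows "mset_set ({subset_sum I, subset_sum J} \<union> D) \<in> zs_atoms G"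
proof -
  let ?f = "subset_sum I" and ?g = "subset_sum J"
  let ?T = "{?f, ?g} \<union> D"
  note cE = atom_setD(1)[OF E]
  have c: "?f \<in> carrier G" "?g \<in> carrier G" "?T \<subseteq> carrier G" "D \<subseteq> carrier G"
    using I J D cE by (auto intro!: subset_sum_closed)
  have pair: "subset_sum {?f, ?g} = ?f \<otimes> ?g"
    using subset_sum_disjoint[of "{?f}" "{?g}"] c ne by (auto simp: insert_commute)
  have "subset_sum ?T = (?f \<otimes> ?g) \<otimes> (?f \<otimes> ?g)"
    using subset_sum_disjoint[of "{?f, ?g}" D] c pair D I J by auto
  then have T1: "subset_sum ?T = \<one>" using c square by simp
  show ?thesis
    unfolding zs_atoms_iff
  proof (intro conjI ballI impI)
    show "mset_set ?T \<in> zero_sum_seqs G" using mset_set_zero_sum_iff[OF c(3)] T1 by simp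
    show "mset_set ?T \<noteq> {#}" using finite_sub[OF c(3)] by (simp add: mset_set_empty_iff)
    fix V assume V: "V \<in> zero_sum_seqs G" "V \<subseteq># mset_set ?T"
    define K where "K = set_mset V"
    have VK: "V = mset_set K"
    proof (rule multiset_eqI)
      fix x
      have "count V x \<le> count (mset_set ?T) x" using V(2) by (rule mset_subset_eq_count)
      also have "\<dots> \<le> 1" by (simp add: count_mset_set')
      finally show "count V x = count (mset_set K) x"
        unfolding K_def by (cases "x \<in># V") (auto simp: not_in_iff le_Suc_eq simp flip: count_greater_zero_iff)
    qed
    have KT: "K \<subseteq> ?T"
      using set_mset_mono[OF V(2)] finite_sub[OF c(3)] unfolding K_def by simp
    have K1: "subset_sum K = \<one>" using V(1) mset_set_zero_sum_iff[of K] KT c(3) VK by auto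
    define K' where "K' = K \<inter> D"
    have K'D: "K' \<subseteq> D" and K'E: "K' \<subseteq> E" using D(1) unfolding K'_def by auto
    have K'c: "subset_sum K' \<in> carrier G" using K'E cE by (intro subset_sum_closed) auto
    have nI: "subset_sum K' \<noteq> ?f"
      using subset_sum_eqD[OF E K'E I(1)] K'D not_sub by blast
    have nJ: "subset_sum K' \<noteq> ?g"
      using subset_sum_eqD[OF E K'E J(1)] K'D not_sub by blast
    have fg: "?f \<notin> K'" "?g \<notin> K'" "K' \<subseteq> carrier G" using D I J K'D c(4) by auto
    consider "?f \<notin> K" "?g \<notin> K" | "?f \<in> K" "?g \<notin> K" | "?f \<notin> K" "?g \<in> K" | "?f \<in> K" "?g \<in> K" by blast
    then have "K = {} \<or> K = ?T"
    proof cases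
      case 1
      then have "K = K'" using KT unfolding K'_def by blast
      then have "K = {} \<or> K = E" using atom_setD(5)[OF E K'E] K1 by simp
      then show ?thesis using \<open>K = K'\<close> K'D not_sub I by blast
    next
      case 2
      then have "K = {?f} \<union> K'" using KT unfolding K'_def by blast
      then have "?f \<otimes> subset_sum K' = \<one>"
        using subset_sum_disjoint[of "{?f}" K'] K1 c fg by auto
      then show ?thesis using mult_eq_one_iff[OF c(1) K'c] nI by simp
    next
      case 3
      then have "K = {?g} \<union> K'" using KT unfolding K'_def by blast
      then have "?g \<otimes> subset_sum K' = \<one>"
        using subset_sum_disjoint[of "{?g}" K'] K1 c fg by auto
      then show ?thesis using mult_eq_one_iff[OF c(2) K'c] nJ by simp
    next
      case 4
      then have K: "K = {?f, ?g} \<union> K'" using KT unfolding K'_def by blast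
      then have "(?f \<otimes> ?g) \<otimes> subset_sum K' = \<one>"
        using subset_sum_disjoint[of "{?f, ?g}" K'] K1 c fg pair by auto
      then have "subset_sum D = subset_sum K'" using mult_eq_one_iff[OF _ K'c] c D(2) by simp
      then have "D = K' \<or> D = E - K'" using subset_sum_eqD[OF E D(1) K'E] by blast
      then have "D = K'" using K'D not_sub I by blast
      then show ?thesis using K by simp
    qed
    then show "V = {#} \<or> V = mset_set ?T" using VK by auto
  qed
qed

text \<open>
  Writing \<open>f\<close> and \<open>f'\<close> for the two sums, \<open>f\<^sup>2 f'\<^sup>2 E\<close> has the factorization into \<open>f\<^sup>2\<close>, \<open>f'\<^sup>2\<close>
  and \<open>E\<close>, and the one into \<open>f f'\<close> times the symmetric difference of \<open>I\<close> and \<open>J\<close> and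
  \<open>f f'\<close> times its complement.
\<close>
lemma crossing_lengths:
  assumes E: "atom_set E" and I: "I \<subseteq> E" "subset_sum I \<notin> E" "subset_sum I \<noteq> \<one>"
    and J: "J \<subseteq> E" "subset_sum J \<notin> E" "subset_sum J \<noteq> \<one>"
    and cross: "I \<inter> J \<noteq> {}" "I - J \<noteq> {}" "J - I \<noteq> {}" "E - (I \<union> J) \<noteq> {}"
  defines "B \<equiv> {#subset_sum I, subset_sum I#} + {#subset_sum J, subset_sum J#} + mset_set E"
  shows "2 \<in> length_set G B" "3 \<in> length_set G B" "subset_sum I \<noteq> subset_sum J"
proof -
  let ?f = "subset_sum I" and ?g = "subset_sum J"
  note cE = atom_setD(1)[OF E] and finE = atom_setD(2)[OF E]
  have c: "?f \<in> carrier G" "?g \<in> carrier G"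
    using I J cE by (auto intro!: subset_sum_closed)
  have ne: "?f \<noteq> ?g" using subset_sum_eqD[OF E I(1) J(1)] cross I J by blast
  then show "subset_sum I \<noteq> subset_sum J" .
  let ?D = "sym_diff I J"
  have D: "?D \<subseteq> E" "subset_sum ?D = ?f \<otimes> ?g"
    using I J subset_sum_sym_diff[of I J] cE by auto
  have D': "E - ?D \<subseteq> E" "subset_sum (E - ?D) = ?f \<otimes> ?g"
    using subset_sum_complement[OF E D(1)] D(2) by auto
  let ?T = "{?f, ?g} \<union> ?D" and ?T' = "{?f, ?g} \<union> (E - ?D)"
  have T: "mset_set ?T \<in> zs_atoms G"
    by (rule atom_set_extend[OF E I(1,2) J(1,2) ne D]) (use cross I(1) J(1) in blast)+
  have T': "mset_set ?T' \<in> zs_atoms G"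
    by (rule atom_set_extend[OF E I(1,2) J(1,2) ne D']) (use cross I(1) J(1) in blast)+
  have fin_T: "finite ?T" "finite ?T'" using D(1) finE finite_subset by auto
  have "mset_set ?T + mset_set ?T' = B"
  proof (rule multiset_eqI)
    fix x
    show "count (mset_set ?T + mset_set ?T') x = count B x"
      using fin_T finE I(1,2) J(1,2) ne unfolding B_def by (auto simp: count_mset_set')
  qed
  then show "2 \<in> length_set G B"
    using length_set_add[OF length_set_atom[OF T] length_set_atom[OF T']] by (simp add: numeral_2_eq_2)
  have "{#?f, ?f#} \<in> zs_atoms G" "{#?g, ?g#} \<in> zs_atoms G"
    using pair_atom[of ?f] pair_atom[of ?g] c I(3) J(3) by simp_all
  moreover have "mset_set E \<in> zs_atoms G" using E by (simp add: atom_set_def)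
  ultimately have "1 + 1 + 1 \<in> length_set G B"
    unfolding B_def by (intro length_set_add length_set_atom)
  then show "3 \<in> length_set G B" by (simp add: numeral_3_eq_3)
qed

text \<open>
  If the atoms of length \<open>r + 1\<close> all equal \<open>U\<close>, a factorization consists of \<open>u\<close> copies of \<open>U\<close> and of
  squares, so that its length \<open>k\<close> satisfies \<open>|B| = 2 k + (r - 1) u\<close>; here \<open>u\<close> is even because every
  multiplicity in \<open>B\<close> is even.
\<close>
lemma lengths_of_extremal:
  assumes Y: "set_mset Y \<subseteq> zs_atoms G" "\<Sum>\<^sub># Y = B" "\<forall>U\<in>#Y. size U = Suc r"
    and Z: "set_mset Z \<subseteq> zs_atoms G" "\<Sum>\<^sub># Z = B" "\<forall>U\<in>#Z. size U = 2"
  shows "(\<exists>k. k \<in> length_set G B \<and> Suc k \<in> length_set G B) \<or>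
         (\<forall>k\<in>length_set G B. \<forall>l\<in>length_set G B. [k = l] (mod (r - 1)))"
proof -
  have even: "even (count B x)" for x
  proof -
    have "even (count (\<Sum>\<^sub># Z) x)" using Z(1,3)
    proof (induction Z)
      case (add V Z)
      then obtain y where "V = {#y, y#}" using square_atom[of V] by auto
      then show ?case using add by auto
    qed auto
    then show ?thesis using Z(2) by simp
  qed
  have at: "atom_set (set_mset U)" "card (set_mset U) = Suc r" "mset_set (set_mset U) = U" if "U \<in># Y" for U
    using atom_set_of_atom[of U] that Y r by auto
  show ?thesis
  proof (cases "\<exists>U\<in>#Y. \<exists>V\<in>#Y. U \<noteq> V")
    case True
    then obtain U V where UV: "U \<in># Y" "V \<in># Y" "U \<noteq> V" by blast
    let ?E = "set_mset U" and ?F = "set_mset V"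
    have "?E \<noteq> ?F" using at(3) UV by metis
    then obtain I J where IJ: "I \<subseteq> ?E" "J \<subseteq> ?E" "subset_sum I \<in> ?F - ?E" "subset_sum J \<in> ?F - ?E"
      and cross: "I \<inter> J \<noteq> {}" "I - J \<noteq> {}" "J - I \<noteq> {}" "?E - (I \<union> J) \<noteq> {}"
      using ex_crossing at UV by metis
    have "\<one> \<notin> ?F"
    proof
      assume "\<one> \<in> ?F"
      then have "V = {#\<one>#}" using atom_with_one Y(1) UV by blast
      then show False using Y(3) UV r by auto
    qed
    then have ne: "subset_sum I \<noteq> \<one>" "subset_sum J \<noteq> \<one>" using IJ by auto
    let ?D = "{#subset_sum I, subset_sum I#} + {#subset_sum J, subset_sum J#} + mset_set ?E"
    have l: "2 \<in> length_set G ?D" "3 \<in> length_set G ?D" "subset_sum I \<noteq> subset_sum J"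
      using crossing_lengths[OF at(1)[OF UV(1)], of I J] IJ ne cross by auto
    have UB: "?E \<subseteq> set_mset B" "?F \<subseteq> set_mset B" using UV Y(2) by (auto simp: in_Union_mset_iff)
    have two: "2 \<le> count B x" if "x \<in># B" for x
      using even[of x] that by (metis count_eq_zero_iff dvd_imp_le neq0_conv)
    \<comment> \<open>the two sums occur in \<open>F\<close>, hence at least twice in \<open>B\<close>, where all multiplicities are even\<close>
    have "?D \<subseteq># B"
    proof (rule mset_subset_eqI)
      fix x
      show "count ?D x \<le> count B x"
      proof (cases "x \<in># B")
        case True
        have "count ?D x \<le> 2" using l(3) IJ by (auto simp: count_mset_set')
        then show ?thesis using two[OF True] by linarith
      next
        case False
        then show ?thesis using UB IJ by (auto simp: count_mset_set')
      qed
    qed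
    then have B: "B = ?D + (B - ?D)" by (rule subset_mset.add_diff_inverse[symmetric])
    have "B \<in> zero_sum_seqs G" using zero_sum_of_atoms[OF Y(1)] Y(2) by simp
    then have "B - ?D \<in> zero_sum_seqs G"
      using zero_sum_diff[OF length_set_zero_sum[OF l(1)]] \<open>?D \<subseteq># B\<close> by blast
    then obtain m where "m \<in> length_set G (B - ?D)" using length_set_nonempty by blast
    then have "2 + m \<in> length_set G B" "3 + m \<in> length_set G B"
      using length_set_add[OF l(1)] length_set_add[OF l(2)] B by metis+
    moreover have "3 + m = Suc (2 + m)" by simp
    ultimately have "2 + m \<in> length_set G B \<and> Suc (2 + m) \<in> length_set G B" by metis
    then show ?thesis by blast
  next
    case False
    have "[k = l] (mod (r - 1))" if kl: "k \<in> length_set G B" "l \<in> length_set G B" for k l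
    proof (cases "Y = {#}")
      case True
      then have "B = {#}" using Y(2) by auto
      then show ?thesis using kl by (simp add: length_set_def)
    next
      case ne: False
      then obtain U where U: "U \<in># Y" by blast
      have UA: "U \<in> zs_atoms G" "size U = Suc r" using U Y by auto
      obtain e where e: "e \<in># U" using zs_atomD(2)[OF UA(1)] by blast
      have "set_mset (\<Sum>\<^sub># Y) \<subseteq> set_mset U" using False U by (auto simp: in_Union_mset_iff)
      then have BU: "set_mset B \<subseteq> set_mset U" using Y(2) by simp
      have two: "V = U \<or> (\<exists>x. V = {#x, x#})" if V: "V \<in> zs_atoms G" "set_mset V \<subseteq> set_mset U" for V
      proof (cases "size V = 2")
        case True
        then show ?thesis using square_atom V(1) by blast
      next
        case f: False
        have "mset_set (set_mset V) \<subseteq># mset_set (set_mset U)"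
          using V(2) by (intro subset_imp_msubset_mset_set) auto
        then have "V \<subseteq># U" using at(3)[OF U] squarefree_atom[OF V(1) f] by simp
        then show ?thesis using zs_atom_minimal[OF UA(1)] zs_atomD(1,2)[OF V(1)] by blast
      qed
      have ce: "count U e = 1" using e at(3)[OF U] by (metis count_mset_set(1) finite_set_mset)
      have main: "\<exists>u. size (\<Sum>\<^sub># W) = 2 * size W + (r - 1) * u \<and> (even u \<longleftrightarrow> even (count (\<Sum>\<^sub># W) e))"
        if "set_mset W \<subseteq> zs_atoms G" "set_mset (\<Sum>\<^sub># W) \<subseteq> set_mset U" for W
        using that
      proof (induction W)
        case empty
        then show ?case by (intro exI[of _ 0]) auto
      next
        case (add V W)
        then obtain u where u: "size (\<Sum>\<^sub># W) = 2 * size W + (r - 1) * u"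
          "even u \<longleftrightarrow> even (count (\<Sum>\<^sub># W) e)" by auto
        have "V = U \<or> (\<exists>x. V = {#x, x#})" using add.prems by (intro two) auto
        then show ?case
        proof
          assume "V = U"
          then have "size (\<Sum>\<^sub># (add_mset V W)) = 2 * size (add_mset V W) + (r - 1) * Suc u"
            using u(1) UA(2) r by simp
          moreover have "even (Suc u) \<longleftrightarrow> even (count (\<Sum>\<^sub># (add_mset V W)) e)"
            using u(2) ce \<open>V = U\<close> by simp
          ultimately show ?thesis by blast
        next
          assume "\<exists>x. V = {#x, x#}"
          then obtain x where V: "V = {#x, x#}" by blast
          then have "even (count V e)" by (cases "x = e") auto
          then have "even u \<longleftrightarrow> even (count (\<Sum>\<^sub># (add_mset V W)) e)" using u(2) by simp
          moreover have "size (\<Sum>\<^sub># (add_mset V W)) = 2 * size (add_mset V W) + (r - 1) * u"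
            using u(1) V by simp
          ultimately show ?thesis by blast
        qed
      qed
      have half: "\<exists>w. size B = 2 * (m + (r - 1) * w)" if m: "m \<in> length_set G B" for m
      proof -
        obtain W where W: "set_mset W \<subseteq> zs_atoms G" "size W = m" "\<Sum>\<^sub># W = B"
          using m by (auto simp: length_set_iff)
        then obtain u where u: "size B = 2 * m + (r - 1) * u" "even u"
          using main[of W] BU even by auto
        then obtain w where "u = 2 * w" by (elim evenE)
        then have "size B = 2 * (m + (r - 1) * w)" using u(1) by simp
        then show ?thesis by blast
      qed
      obtain w w' where "size B = 2 * (k + (r - 1) * w)" "size B = 2 * (l + (r - 1) * w')"
        using half kl by metis
      then have "k + (r - 1) * w = l + (r - 1) * w'" by simp
      then have "(k + (r - 1) * w) mod (r - 1) = (l + (r - 1) * w') mod (r - 1)"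
        by (rule arg_cong[where f = "\<lambda>z. z mod (r - 1)"])
      then show ?thesis by (simp only: mod_mult_self2 cong_def)
    qed
    then show ?thesis by blast
  qed
qed

end

lemma two_group_elementary_2_group:
  assumes "2 \<le> r"
  shows "two_group (elementary_2_group r) r"
proof -
  let ?Z = "\<lambda>_::nat. integer_mod_group 2"
  let ?H = "elementary_2_group r"
  have H: "?H = sum_group {..<r} ?Z" by (simp add: elementary_2_group_def)
  have carr: "carrier ?H = (\<Pi>\<^sub>E i\<in>{..<r}. {0, 1})"
  proof -
    have "carrier (integer_mod_group 2) = {0, 1}" by (auto simp: carrier_integer_mod_group)
    moreover have "finite {i \<in> {..<r}. P i}" for P by simp
    ultimately show ?thesis
      unfolding H by (subst carrier_sum_group) (simp_all only: group_integer_mod_group simp_thms Collect_mem_eq)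
  qed
  have "group ?H" unfolding H by simp
  moreover have "x \<otimes>\<^bsub>?H\<^esub> y = y \<otimes>\<^bsub>?H\<^esub> x" for x y
    unfolding H by (simp add: add.commute)
  ultimately have "comm_group ?H" by (intro group.group_comm_groupI)
  moreover have "x \<otimes>\<^bsub>?H\<^esub> x = \<one>\<^bsub>?H\<^esub>" if "x \<in> carrier ?H" for x
  proof -
    have "(z + z) mod 2 = 0" for z :: int by presburger
    then show ?thesis unfolding H by simp
  qed
  moreover have "order ?H = 2 ^ r"
    unfolding order_def carr by (simp add: card_PiE numeral_2_eq_2)
  ultimately show ?thesis
    using assms by (simp add: two_group_def two_group_axioms_def)
qed

section \<open>Sequences of maximal elasticity over a cyclic group\<close>

context comm_group
begin

lemma carrier_eq_powers:
  assumes "finite (carrier G)" "x \<in> carrier G" "ord x = order G"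
  shows "carrier G = (\<lambda>k. x [^] k) ` {0..order G - 1}"
proof -
  have "0 < order G" using assms(1) order_gt_0_iff_finite by simp
  have "(\<lambda>k::nat. x [^] k) ` {0..order G - 1} = carrier G"
  proof (rule card_subset_eq[OF assms(1)])
    show "(\<lambda>k::nat. x [^] k) ` {0..order G - 1} \<subseteq> carrier G" using assms(2) by auto
    have "inj_on (\<lambda>k::nat. x [^] k) {0..order G - 1}" using ord_inj[OF assms(2)] assms(3) by simp
    then show "card ((\<lambda>k::nat. x [^] k) ` {0..order G - 1}) = card (carrier G)"
      using \<open>0 < order G\<close> by (simp add: card_image order_def)
  qed
  then show ?thesis by simp
qed

lemma extremal_support:
  assumes n: "3 \<le> order G" and A: "A \<in> zero_sum_seqs G"
    and el: "elasticity (length_set G A) = real (order G) / 2"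
  shows "A \<noteq> {#}" "\<And>x. x \<in># A \<Longrightarrow> x \<in> carrier G \<and> ord x = order G \<and> inv x \<in># A"
proof -
  have fin: "finite (carrier G)" using n order_gt_0_iff_finite by simp
  show "A \<noteq> {#}" using elasticity_eq_iff[OF n A] el by blast
  have "2 * Max (length_set G A) = order G * Min (length_set G A)"
    using elasticity_eq_iff[OF n A] el by blast
  from Max_Min_length_set(2)[OF n size_atom_le_order[OF fin] A this]
  obtain Y Z where Y: "set_mset Y \<subseteq> zs_atoms G" "\<Sum>\<^sub># Y = A" "\<forall>U\<in>#Y. size U = order G"
    and Z: "set_mset Z \<subseteq> zs_atoms G" "\<Sum>\<^sub># Z = A" "\<forall>U\<in>#Z. size U = 2" by blast
  fix x assume x: "x \<in># A"
  then obtain U where U: "U \<in># Y" "x \<in># U" using Y(2) in_Union_mset_iff by metis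
  then have "U \<in> zs_atoms G" "size U = order G" using Y(1,3) by blast+
  from atom_of_order_length[OF fin this] obtain z where
    "z \<in> carrier G" "ord z = order G" "U = replicate_mset (order G) z" by blast
  then have "ord x = order G \<and> x \<in> carrier G" using U(2) by (auto split: if_splits)
  moreover obtain V where V: "V \<in># Z" "x \<in># V" using x Z(2) in_Union_mset_iff by metis
  have "size V = 2" using Z(3) V by blast
  then have "size (V - {#x#}) = 1" using V(2) by (simp add: size_Diff_singleton)
  then obtain y where "V - {#x#} = {#y#}" using size_1_singleton_mset by blast
  then have Vy: "V = {#x, y#}" using V(2) by (metis insert_DiffM)
  then have "y = inv x" using zs_atomD(1)[of V] Z(1) V(1) pair_zero_sum_iff[of x y] by auto
  then have "inv x \<in># A" using Vy V(1) Z(2) in_Union_mset_iff[of "inv x" Z] by auto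
  ultimately show "x \<in> carrier G \<and> ord x = order G \<and> inv x \<in># A" by blast
qed

end

lemma (in generator_pair) extremal_quad:
  assumes "order G = n" "coprime a n" "3 \<le> n"
  shows "quad n n n n \<in> zero_sum_seqs G"
    "elasticity (length_set G (quad n n n n)) = real n / 2"
    "set_mset (quad n n n n) = four"
proof -
  have fin: "finite (carrier G)" using assms order_gt_0_iff_finite by simp
  have "ord h = n" unfolding h_def using pow_ord_eq_ord_iff[OF fin g(1)] g(2) assms(2) by simp
  then have oh: "ord h = n" "ord (inv h) = n" by simp_all
  have R: "replicate_mset n h \<in> zs_atoms G" "replicate_mset n (inv h) \<in> zs_atoms G"
    using replicate_ord_atom[of h] replicate_ord_atom[of "inv h"] oh n_gt by simp_all
  define Y where "Y = {#quad n 0 0 0, quad 0 n 0 0, quad 0 0 n 0, quad 0 0 0 n#}"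
  define Z where "Z = replicate_mset n (quad 1 1 0 0) + replicate_mset n (quad 0 0 1 1)"
  have sz: "size (quad x x' y y') = x + x' + y + y'" for x x' y y' by (simp add: quad_def)
  have "quad 0 0 n 0 = replicate_mset n h" "quad 0 0 0 n = replicate_mset n (inv h)"
    by (simp_all add: quad_def)
  then have "set_mset Y \<subseteq> zs_atoms G" using basic_atoms R unfolding Y_def by auto
  moreover have "\<Sum>\<^sub># Y = quad n n n n" "\<forall>U\<in>#Y. size U = n"
    unfolding Y_def by (simp_all add: quad_add sz)
  ultimately have Y: "set_mset Y \<subseteq> zs_atoms G" "\<Sum>\<^sub># Y = quad n n n n" "\<forall>U\<in>#Y. size U = n" by auto
  have rep: "\<Sum>\<^sub># (replicate_mset m V) = repeat_mset m V" for m and V :: "'a multiset"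
    by (induction m) auto
  have inZ: "U = quad 1 1 0 0 \<or> U = quad 0 0 1 1" if "U \<in># Z" for U
    using that unfolding Z_def by (metis in_replicate_mset union_iff)
  have Z: "set_mset Z \<subseteq> zs_atoms G" "\<forall>U\<in>#Z. size U = 2"
  proof -
    show "set_mset Z \<subseteq> zs_atoms G" using inZ basic_atoms(1,2) by blast
    have "size (quad 1 1 0 0) = 2" "size (quad 0 0 1 1) = 2" by (simp_all add: sz)
    then show "\<forall>U\<in>#Z. size U = 2" using inZ by metis
  qed
  have sumZ: "\<Sum>\<^sub># Z = quad n n n n"
    unfolding Z_def by (simp add: rep repeat_quad quad_add)
  show "quad n n n n \<in> zero_sum_seqs G" using zero_sum_of_atoms[OF Y(1)] Y(2) by simp
  have "quad n n n n \<noteq> {#}" using n_gt by (simp add: quad_empty_iff)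
  then show "elasticity (length_set G (quad n n n n)) = real n / 2"
    using extremal_elasticity[OF assms(3) _ _ Y Z(1) sumZ Z(2)] size_atom_le_order[OF fin] assms(1) by simp
  show "set_mset (quad n n n n) = four" using n_gt by (auto simp: quad_def)
qed

context comm_group
begin

text \<open>Write \<open>y\<close> or \<open>-y\<close>, whichever has the smaller coefficient, as a multiple of \<open>x\<close>.\<close>
lemma ex_generator_pair:
  assumes fin: "finite (carrier G)" and x: "x \<in> carrier G" "ord x = order G"
    and y: "y \<in> carrier G" "ord y = order G" "y \<noteq> x" "y \<noteq> inv x" and n: "3 \<le> order G"
  shows "\<exists>a. generator_pair G x (order G) a \<and> coprime a (order G) \<and>
           {y, inv y} = {x [^] a, inv (x [^] a)}"
proof -
  let ?n = "order G"
  obtain k where k: "y = x [^] k" "k < ?n"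
    using carrier_eq_powers[OF fin x] y(1) n by (force simp: image_iff)
  have cop: "coprime k ?n" using pow_ord_eq_ord_iff[OF fin x(1), of k] x(2) y(2) k(1) by simp
  have k0: "k \<noteq> 0"
  proof
    assume "k = 0"
    then show False using cop n by simp
  qed
  have k1: "k \<noteq> 1" using k(1) y(3) x(1) by auto
  have flip: "inv y = x [^] (?n - k)"
  proof (rule inv_equality)
    have "x [^] (?n - k) \<otimes> y = x [^] ?n" using k x(1) by (simp add: nat_pow_mult)
    then show "x [^] (?n - k) \<otimes> y = \<one>" using x pow_ord_eq_1[OF x(1)] by simp
  qed (use x y in auto)
  have kn1: "?n - k \<noteq> 1"
  proof
    assume "?n - k = 1"
    then have "inv y = x" using flip x(1) by simp
    then show False using y(1,4) inv_inv by metis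
  qed
  have "2 * k \<noteq> ?n"
  proof
    assume "2 * k = ?n"
    then have "k dvd ?n" by (metis dvd_triv_right)
    then show False using cop k1 coprime_common_divisor[of k ?n k] by simp
  qed
  then consider "2 * k < ?n" | "2 * (?n - k) < ?n" using k(2) by linarith
  then show ?thesis
  proof cases
    case 1
    have "generator_pair G x ?n k"
      using x k0 k1 1 by unfold_locales auto
    then show ?thesis using cop k(1) by blast
  next
    case 2
    have "generator_pair G x ?n (?n - k)"
      using x k(2) kn1 2 by unfold_locales auto
    moreover have "coprime (?n - k) ?n"
      using cop k(2) by (metis coprime_iff_gcd_eq_1 gcd.commute gcd_diff2_nat less_imp_le)
    moreover have "{y, inv y} = {x [^] (?n - k), inv (x [^] (?n - k))}"
      using flip y(1) by (metis inv_inv insert_commute)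
    ultimately show ?thesis by blast
  qed
qed

lemma group_elasticity_eq:
  assumes n: "3 \<le> n" and bd: "\<And>U. U \<in> zs_atoms G \<Longrightarrow> size U \<le> n"
    and A: "A \<in> zero_sum_seqs G" "elasticity (length_set G A) = real n / 2"
  shows "group_elasticity G = ereal (real n / 2)"
  unfolding group_elasticity_def
proof (rule antisym)
  show "(SUP L\<in>length_sets G. ereal (elasticity L)) \<le> ereal (real n / 2)"
  proof (rule SUP_least)
    fix L assume "L \<in> length_sets G"
    then obtain B where "B \<in> zero_sum_seqs G" "L = length_set G B" by (auto simp: length_sets_def)
    then show "ereal (elasticity L) \<le> ereal (real n / 2)" using elasticity_le[OF n bd] by simp
  qed
  have "length_set G A \<in> length_sets G" using A(1) by (simp add: length_sets_def)
  then show "ereal (real n / 2) \<le> (SUP L\<in>length_sets G. ereal (elasticity L))"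
    using A(2) by (metis (no_types, lifting) SUP_upper)
qed

lemma group_elasticity_cyclic:
  assumes n: "3 \<le> order G" and x: "x \<in> carrier G" "ord x = order G"
  shows "group_elasticity G = ereal (real (order G) / 2)"
proof -
  let ?n = "order G"
  have fin: "finite (carrier G)" using n order_gt_0_iff_finite by simp
  define A where "A = replicate_mset ?n x + replicate_mset ?n (inv x)"
  define Y where "Y = {#replicate_mset ?n x, replicate_mset ?n (inv x)#}"
  define Z where "Z = replicate_mset ?n {#x, inv x#}"
  have "\<Sum>\<^sub># (replicate_mset m {#x, y#}) = replicate_mset m x + replicate_mset m y" for m and y :: 'a
    by (induction m) auto
  moreover have "x \<noteq> \<one>" using x n by auto
  ultimately have Z: "set_mset Z \<subseteq> zs_atoms G" "\<Sum>\<^sub># Z = A" "\<forall>U\<in>#Z. size U = 2"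
    using pair_atom[OF x(1)] unfolding Z_def A_def by (auto split: if_splits)
  have Y: "set_mset Y \<subseteq> zs_atoms G" "\<Sum>\<^sub># Y = A" "\<forall>U\<in>#Y. size U = ?n"
    using replicate_ord_atom[of x] replicate_ord_atom[of "inv x"] x n unfolding Y_def A_def by auto
  have "A \<noteq> {#}" using n unfolding A_def by auto
  then have "elasticity (length_set G A) = real ?n / 2"
    using extremal_elasticity[OF n _ _ Y Z] size_atom_le_order[OF fin] by simp
  moreover have "A \<in> zero_sum_seqs G" using zero_sum_of_atoms[OF Y(1)] Y(2) by simp
  ultimately show ?thesis using group_elasticity_eq[OF n size_atom_le_order[OF fin]] by blast
qed

lemma power_distances_nonempty:
  assumes "A \<in> zero_sum_seqs G" "x \<in> length_set G A" "y \<in> length_set G A" "x < y"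
  shows "power_distances G A \<noteq> {}"
proof -
  have "distances (length_set G (repeat_mset 1 A)) \<noteq> {}"
    using ex_distance_le[of x "length_set G A" y] assms by auto
  then show ?thesis unfolding power_distances_def by blast
qed

lemma extremal_power_distances_nonempty:
  assumes n: "3 \<le> n" and A: "A \<in> zero_sum_seqs G" and el: "elasticity (length_set G A) = real n / 2"
  shows "power_distances G A \<noteq> {}"
proof -
  let ?L = "length_set G A"
  have *: "A \<noteq> {#}" "2 * Max ?L = n * Min ?L" using elasticity_eq_iff[OF n A] el by auto
  have in_L: "Min ?L \<in> ?L" "Max ?L \<in> ?L" using finite_length_set length_set_nonempty[OF A] by auto
  then have "0 < Min ?L" using length_set_pos *(1) by blast
  then have "2 * Min ?L < n * Min ?L" using n by simp
  then have "Min ?L < Max ?L" using *(2) by linarith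
  then show ?thesis using power_distances_nonempty[OF A in_L] by blast
qed

end

section \<open>The two conditions are equivalent\<close>

locale cyclic_group_of_order = comm_group +
  fixes n :: nat
  assumes n: "6 \<le> n" and order: "order G = n" and cyclic: "cyclic_group G"
begin

lemma fin: "finite (carrier G)"
  using n order order_gt_0_iff_finite by simp

lemma n3: "3 \<le> n" "3 \<le> order G" using n order by simp_all

lemma ex_generator: "\<exists>x\<in>carrier G. ord x = n"
proof -
  obtain x where x: "x \<in> carrier G" "subgroup_generated G {x} = G"
    using cyclic unfolding cyclic_group_def by blast
  have "carrier G = generate G (carrier G \<inter> {x})"
    using carrier_subgroup_generated[of G "{x}"] x(2) by simp
  also have "carrier G \<inter> {x} = {x}" using x(1) by simp
  finally have "carrier G = generate G {x}" .
  then have "ord x = order G"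
    using generate_pow_card[OF x(1)] by (simp add: order_def)
  then show ?thesis using x order by blast
qed

lemma elasticity_value: "group_elasticity G = ereal (real n / 2)"
  using ex_generator group_elasticity_cyclic[OF n3(2)] order by auto

lemma Delta_rho_star_iff:
  "d \<in> Delta_rho_star G \<longleftrightarrow>
     (\<exists>A\<in>zero_sum_seqs G. elasticity (length_set G A) = real n / 2 \<and> d = Inf (power_distances G A))"
  unfolding Delta_rho_star_def elasticity_value by auto

text \<open>
  A support of the form \<open>{x, -x}\<close> would give \<open>d = n - 2\<close>, so there are two essentially different generators
  in the support.
\<close>
lemma cfrac_condition_if_distance:
  assumes A: "A \<in> zero_sum_seqs G" "elasticity (length_set G A) = real n / 2"
    and d: "d = Inf (power_distances G A)" "d \<noteq> 1" "d \<noteq> n - 2"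
  shows "cfrac_condition n"
proof -
  have ne: "power_distances G A \<noteq> {}" using extremal_power_distances_nonempty[OF n3(1) A] .
  have M: "length_modulus G (set_mset A) d"
    using length_modulus_min_power_distance[OF A(1) ne] d(1) by simp
  have "d \<in> power_distances G A" using Inf_nat_def1[OF ne] d(1) by simp
  then have "0 < d" using power_distancesE by metis
  note supp = extremal_support[OF n3(2) A(1), unfolded order, OF A(2)]
  obtain x where x: "x \<in># A" using supp(1) by blast
  have "\<exists>y. y \<in># A \<and> y \<noteq> x \<and> y \<noteq> inv x"
  proof (rule ccontr)
    assume "\<not> ?thesis"
    then have sub: "set_mset A \<subseteq> {x, inv x}" by blast
    interpret gp: generator_pair G x n 2
      using supp(2)[OF x] n by unfold_locales auto
    have "length_modulus G (set_mset A) (n - 2)"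
      using length_modulus_subset[OF gp.length_modulus_single_pair sub] .
    then have "n - 2 dvd d"
      using length_modulus_dvd_power_distance[OF A(1)] \<open>d \<in> power_distances G A\<close> by blast
    moreover have "length_modulus G {x, inv x} d"
      using length_modulus_subset[OF M] supp(2)[OF x] x by auto
    then have "d dvd n - 2" by (rule gp.length_modulus_dvd)
    ultimately have "d = n - 2" by (simp add: dvd_antisym)
    then show False using d(3) by simp
  qed
  then obtain y where y: "y \<in># A" "y \<noteq> x" "y \<noteq> inv x" by blast
  obtain a where a: "generator_pair G x n a" "coprime a n" "{y, inv y} = {x [^] a, inv (x [^] a)}"
    using ex_generator_pair[OF fin _ _ _ _ y(2,3) n3(2)] supp(2)[OF x] supp(2)[OF y(1)] order by auto
  interpret gp: generator_pair G x n a by (rule a(1))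
  have "{x [^] a, inv (x [^] a)} \<subseteq> set_mset A"
    unfolding a(3)[symmetric] using supp(2)[OF y(1)] y(1) by simp
  then have "gp.four \<subseteq> set_mset A" using supp(2)[OF x] x unfolding gp.h_def by simp
  then have "length_modulus G gp.four d" using length_modulus_subset[OF M] by blast
  then have u: "uniform d a (n - a)" "uniform d (n - a) a" by (rule gp.uniform_if_length_modulus)+
  have ain: "a \<in> {2..n div 2}" using gp.a by auto
  obtain as where as: "is_regular_cfrac as (of_nat n / of_nat a)"
    using ex_cfrac[of a n] gp.n_gt a(2) by blast
  have "d dvd cfrac_gcd as" "0 < cfrac_gcd as"
    using dvd_cfrac_gcd_iff[OF as _ _ a(2)] u ain by auto
  then have "d \<le> cfrac_gcd as" by (simp add: dvd_imp_le)
  then have "cfrac_gcd as > 1" using \<open>0 < d\<close> d(2) by linarith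
  then show ?thesis
    unfolding cfrac_condition_def using ain as a(2) by (metis coprime_iff_gcd_eq_1 gcd.commute)
qed

text \<open>
  The sequence \<open>(g (-g) h (-h))\<^sup>n\<close> has maximal elasticity, and for it \<open>min \<Delta>([A])\<close> is
  exactly the gcd of the continued fraction condition.
\<close>
lemma distance_if_cfrac_condition:
  assumes "cfrac_condition n"
  shows "Delta_rho_star G - {1, n - 2} \<noteq> {}"
proof -
  obtain a as where a: "a \<in> {2..n div 2}" "coprime a n"
    and as: "is_regular_cfrac as (of_nat n / of_nat a)" "cfrac_gcd as > 1"
    using assms unfolding cfrac_condition_def by (metis coprime_iff_gcd_eq_1 gcd.commute)
  have a2: "2 \<le> a" "a \<le> n div 2" using a(1) by auto
  note iff = dvd_cfrac_gcd_iff[OF as(1) a2 a(2)]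
  obtain x where x: "x \<in> carrier G" "ord x = n" using ex_generator by blast
  have "2 * a \<noteq> n"
  proof
    assume "2 * a = n"
    then have "a dvd n" by (metis dvd_triv_right)
    then show False using a(2) a2 coprime_common_divisor[of a n a] by simp
  qed
  then interpret gp: generator_pair G x n a
    using x a2 by unfold_locales auto
  let ?A = "gp.quad n n n n" and ?c = "cfrac_gcd as"
  note A = gp.extremal_quad[OF order a(2) n3(1)]
  let ?d = "Inf (power_distances G ?A)"
  have ne: "power_distances G ?A \<noteq> {}" using extremal_power_distances_nonempty[OF n3(1) A(1,2)] .
  have dp: "?d \<in> power_distances G ?A" using Inf_nat_def1[OF ne] .
  have "uniform ?c a (n - a) \<and> uniform ?c (n - a) a" using iff(1)[of ?c] by simp
  then have "length_modulus G (set_mset ?A) ?c"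
    using gp.length_modulus_if_uniform A(3) by simp
  then have "?c dvd ?d" using length_modulus_dvd_power_distance[OF A(1) _ dp] by blast
  moreover have "0 < ?d" using power_distancesE[OF dp] by metis
  ultimately have "?d \<noteq> 1" using as(2) by auto
  have "length_modulus G gp.four ?d"
    using length_modulus_min_power_distance[OF A(1) ne] A(3) by simp
  then have "?d dvd ?c" using gp.uniform_if_length_modulus iff(1) by blast
  then have "?d \<le> ?c" using iff(2) by (simp add: dvd_imp_le)
  then have "?d \<noteq> n - 2" using iff(3) by linarith
  moreover have "?d \<in> Delta_rho_star G" using Delta_rho_star_iff A(1,2) by blast
  ultimately show ?thesis using \<open>?d \<noteq> 1\<close> by blast
qed

end

section \<open>A set of lengths that elementary 2-groups do not share\<close>

text \<open>
  The witness is \<open>L(A\<^sup>k)\<close> for a power of \<open>A\<close> that has \<open>d\<close> among its distances: neither two consecutive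
  lengths nor a single residue class modulo \<open>n - 2\<close> is compatible with \<open>1 < d < n - 2\<close>.
\<close>
lemma (in cyclic_group_of_order) length_sets_not_subset_two_group:
  assumes A: "A \<in> zero_sum_seqs G" "elasticity (length_set G A) = real n / 2"
    and d: "d = Inf (power_distances G A)" "d \<noteq> 1" "d \<noteq> n - 2"
    and H: "two_group H (n - 1)"
  shows "\<not> length_sets G \<subseteq> length_sets H"
proof
  assume sub: "length_sets G \<subseteq> length_sets H"
  interpret H: two_group H "n - 1" by (rule H)
  have ne: "power_distances G A \<noteq> {}" using extremal_power_distances_nonempty[OF n3(1) A] .
  have dp: "d \<in> power_distances G A" using Inf_nat_def1[OF ne] d(1) by simp
  then obtain k u where k: "u \<in> length_set G (repeat_mset k A)" "u + d \<in> length_set G (repeat_mset k A)" "0 < d"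
    using power_distancesE by metis
  let ?B = "repeat_mset k A"
  let ?L = "length_set G ?B"
  have Bz: "?B \<in> zero_sum_seqs G" using zero_sum_repeat A(1) .
  have "?B \<noteq> {#}"
  proof
    assume "?B = {#}"
    then have "?L = {0}" by (simp add: length_set_def)
    then show False using k by auto
  qed
  obtain Y Z where Y: "set_mset Y \<subseteq> zs_atoms G" "\<Sum>\<^sub># Y = A" "\<forall>U\<in>#Y. size U = n"
    and Z: "set_mset Z \<subseteq> zs_atoms G" "\<Sum>\<^sub># Z = A" "\<forall>U\<in>#Z. size U = 2"
    using Max_Min_length_set(2)[OF n3(2) size_atom_le_order[OF fin] A(1)] elasticity_eq_iff[OF n3(1) A(1)] A(2)
    unfolding order by blast
  have rep: "set_mset (repeat_mset k W) \<subseteq> set_mset W" "\<Sum>\<^sub># (repeat_mset k W) = repeat_mset k (\<Sum>\<^sub># W)"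
    for W :: "'a multiset multiset"
    by (induction k) auto
  have bd: "size U \<le> n" if "U \<in> zs_atoms G" for U using size_atom_le_order[OF fin that] order by simp
  have elB: "elasticity ?L = real n / 2"
    by (rule extremal_elasticity[OF n3(1) bd \<open>?B \<noteq> {#}\<close>, of "repeat_mset k Y" "repeat_mset k Z"])
       (use rep Y Z in \<open>auto dest!: subsetD[OF rep(1)]\<close>)
  have "?L \<in> length_sets G" using Bz by (simp add: length_sets_def)
  then obtain C where C: "C \<in> zero_sum_seqs H" "?L = length_set H C"
    using sub by (auto simp: length_sets_def)
  have bdH: "size U \<le> n" if "U \<in> zs_atoms H" for U using H.size_atom_le[OF that] n by simp
  have "2 * Max (length_set H C) = n * Min (length_set H C)"
    using H.elasticity_eq_iff[OF n3(1) C(1)] elB C(2) by simp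
  from H.Max_Min_length_set(2)[OF n3(1) bdH C(1) this]
  obtain Y' Z' where Y': "set_mset Y' \<subseteq> zs_atoms H" "\<Sum>\<^sub># Y' = C" "\<forall>U\<in>#Y'. size U = Suc (n - 1)"
    and Z': "set_mset Z' \<subseteq> zs_atoms H" "\<Sum>\<^sub># Z' = C" "\<forall>U\<in>#Z'. size U = 2"
    using n by auto
  have mult: "int d dvd int v - int w" if "v \<in> ?L" "w \<in> ?L" for v w
    using min_power_distance_dvd[OF A(1) ne that] d(1) by simp
  from H.lengths_of_extremal[OF Y' Z'] show False
  proof
    assume "\<exists>k. k \<in> length_set H C \<and> Suc k \<in> length_set H C"
    then obtain v where "v \<in> ?L" "Suc v \<in> ?L" using C(2) by auto
    from mult[OF this(2,1)] have "int d dvd 1" by simp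
    then show False using d(2) by simp
  next
    assume "\<forall>k\<in>length_set H C. \<forall>l\<in>length_set H C. [k = l] (mod (n - 1 - 1))"
    then have "[u + d = u] (mod (n - 2))" using k C(2) by (metis diff_diff_left one_add_one)
    then have "n - 2 dvd d" using cong_add_lcancel_0_nat cong_0_iff by blast
    obtain x where x: "x \<in># A" using extremal_support[OF n3(2) A(1), unfolded order, OF A(2)] by blast
    note supp = extremal_support(2)[OF n3(2) A(1), unfolded order, OF A(2) x]
    interpret gp: generator_pair G x n 2
      using supp n by unfold_locales auto
    have "length_modulus G {x, inv x} d"
      using length_modulus_subset[OF length_modulus_min_power_distance[OF A(1) ne]] supp x d(1) by auto
    then have "d dvd n - 2" by (rule gp.length_modulus_dvd)
    then show False using \<open>n - 2 dvd d\<close> d(3) by (simp add: dvd_antisym)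
  qed
qed

theorem corollary3p19:
  fixes n :: nat and G :: "'a monoid"
  assumes "n \<ge> 6"
    and "group G" and "cyclic_group G" and "order G = n"
  shows "(Delta_rho_star G - {1, n - 2} \<noteq> {} \<longleftrightarrow> cfrac_condition n) \<and>
         (Delta_rho_star G - {1, n - 2} \<noteq> {} \<or> cfrac_condition n \<longrightarrow>
            \<not> length_sets G \<subseteq> length_sets (elementary_2_group (n - 1)))"
proof -
  interpret group G by fact
  interpret comm_group G by (rule cyclic_imp_abelian_group) fact
  interpret cyclic_group_of_order G n by unfold_locales (use assms in auto)
  have H: "two_group (elementary_2_group (n - 1)) (n - 1)"
    using two_group_elementary_2_group n by simp
  have "cfrac_condition n \<and> \<not> length_sets G \<subseteq> length_sets (elementary_2_group (n - 1))"
    if ne: "Delta_rho_star G - {1, n - 2} \<noteq> {}"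
  proof -
    obtain d where "d \<in> Delta_rho_star G" "d \<noteq> 1" "d \<noteq> n - 2" using ne by blast
    then obtain A where "A \<in> zero_sum_seqs G" "elasticity (length_set G A) = real n / 2"
      "d = Inf (power_distances G A)" "d \<noteq> 1" "d \<noteq> n - 2" unfolding Delta_rho_star_iff by blast
    then show ?thesis using cfrac_condition_if_distance length_sets_not_subset_two_group[OF _ _ _ _ _ H] by blast
  qed
  then show ?thesis using distance_if_cfrac_condition by blast
qed

end
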